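(* The Tarski type construction $\mathcal{T}:\mathbf{StatMeas}\to\mathbf{Mon}$, sending a stationarily measurable space $(X,S,\mathcal{A})$ to its type monoid $\mathcal{T}(X,S,\mathcal{A})$ and a morphism $f$ to $\mathcal{T}f$, is a contravariant functor (co-functor) with the following properties. (1) For every object $(X,S,\mathcal{A})$ of $\mathbf{StatMeas}$ and all $\alpha,\beta\in\mathcal{T}(X,S,\mathcal{A})$: - (Commutativity) $\alpha+\beta=\beta+\alpha$. - (Ordering) The canonical preorder ($\alpha\preceq\beta\iff$ there exists $\gamma$ with $\alpha+\gamma=\beta$) is a partial order on $\mathcal{T}(X,S,\mathcal{A})$. - ($\mathbb{N}$-Cancellation) If $n\alpha=n\beta$ for some integer $n\geq 1$, then $\alpha=\beta$. (2) For every object $(X,S,\mathcal{A})$, the canonical map $m=m_{(X,S,\mathcal{A})}:\mathcal{A}\to\mathcal{T}(X,S,\mathcal{A})$, $m(A)=[A]$ (Tarski measure), satisfies: - (Null identity) $m(\varnothing)=0$, the additive identity of $\mathcal{T}(X,S,\mathcal{A})$. - (Countable additivity) If $\{A_i\}_{i=1}^\infty$ is a sequence of pairwise disjoint sets in $\mathcal{A}$, then $m\left(\bigcup_{i=1}^\infty A_i\right)=\sum_{i=1}^\infty m(A_i)$. - (Stationarity) $m(A)=m(s^{-1}A)$ for all $A\in\mathcal{A}$ and all $s\in S$. (3) For every morphism $f:(X,S,\mathcal{A})\to(Y,T,\mathcal{B})$ of $\mathbf{StatMeas}$, the map $\mathcal{T}f:\mathcal{T}(Y,T,\mathcal{B})\to\mathcal{T}(X,S,\mathcal{A})$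 satisfies: - ($\sigma$-homomorphic) $\mathcal{T}f\left(\sum_{i=1}^\infty a_i\right)=\sum_{i=1}^\infty\mathcal{T}f(a_i)$ for all sequences $(a_i)_{i=1}^\infty$ in $\mathcal{T}(Y,T,\mathcal{B})$. - (Commutativity of measurement) $m_{(X,S,\mathcal{A})}\circ f^{-1}=\mathcal{T}f\circ m_{(Y,T,\mathcal{B})}$ as maps $\mathcal{B}\to\mathcal{T}(X,S,\mathcal{A})$.
   Context: An inverse monoid is a monoid $S$ in which every $s$ has a unique weak inverse $s^*$ with $ss^*s=s$ and $s^*ss^*=s^*$. A stationarily measurable space $(X,S,\mathcal{A})$ consists of a set $X$ with a $\sigma$-algebra $\mathcal{A}$ of subsets and an inverse monoid $S$ acting on $X$ from the left by measurable maps: $1$ acts as the identity, $(st)x=s(tx)$, and each map $x\mapsto sx$ is $(\mathcal{A},\mathcal{A})$-measurable. For $s\in S$ and $A\in\mathcal{A}$, $s^{-1}A=\{x\in X: sx\in A\}$ is the preimage. The category $\mathbf{StatMeas}$ has these triples as objects. A morphism $f:(X,S,\mathcal{A})\to(Y,T,\mathcal{B})$ is an $(\mathcal{A},\mathcal{B})$-measurable function $f:X\to Y$ for which there exists an inverse monoid homomorphism $f^*:T\to S$ such that $f^{-1}(t^{-1}(B))=(f^*(t))^{-1}(f^{-1}(B))$ for all $t\in T$, $B\in\mathcal{B}$. $\mathbf{Mon}$ is the category of monoids and monoid homomorphisms. $\overline{\mathcal{A}}$ denotes the closure of $\mathcal{A}$ under countable coproducts (disjoint unions): its elements are the coproducts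 $\coprod_{j\in J}P_j$ with $J$ countable and $P_j\in\mathcal{A}$ (realized as $\bigcup_j P_j\times\{j\}$). The representation is unique up to measurable partitions: $\coprod_j P_j$ and $\coprod_k Q_k$ are the same element when there are $R_{jk}\in\mathcal{A}$ with $P_j=\bigsqcup_k R_{jk}$ and $Q_k=\bigsqcup_j R_{jk}$; in particular $A\in\mathcal{A}$ is identified with $\coprod_j A_j$ for any countable measurable partition $(A_j)$ of $A$. $S$ acts by $s^{-1}\left(\coprod_j P_j\right)=\coprod_j s^{-1}P_j$. For $P,Q\in\overline{\mathcal{A}}$, write $P\eqsim_S Q$ ($(S,\overline{\mathcal{A}})$-equidecomposable) iff there are countable collections $(P_j),(Q_j)\subseteq\overline{\mathcal{A}}$ and $(s_j),(t_j)\subseteq S$ with $P=\coprod_j P_j$, $Q=\coprod_j Q_j$ and $s_j^{-1}P_j=t_j^{-1}Q_j$ for all $j$. The type monoid is $\mathcal{T}(X,S,\mathcal{A})=\overline{\mathcal{A}}/\eqsim_S=\{[P]:P\in\overline{\mathcal{A}}\}$ with $[P]+[Q]=[P\coprod Q]$, countable sums $\sum_j[P_j]=\left[\coprod_j P_j\right]$, and $0=[\varnothing]$. For a morphism $f:(X,S,\mathcal{A})\to(Y,T,\mathcal{B})$, $\overline{f}^{-1}:\overline{\mathcal{B}}\to\overline{\mathcal{A}}$ is $\coprod_j B_j\mapsto\coprod_j f^{-1}B_j$ and $\mathcal{T}f([B])=[\overline{f}^{-1}B]$. *)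

theory Defs
  imports "HOL-Analysis.Analysis" "HOL-Algebra.Group" "HOL-Library.Nat_Bijection"
begin

section \<open>Monoids\<close>

locale inverse_monoid = monoid G for G (structure) +
  assumes ex1_weak_inverse:
    "s \<in> carrier G \<Longrightarrow>
      \<exists>!s'. s' \<in> carrier G \<and> s \<otimes> s' \<otimes> s = s \<and> s' \<otimes> s \<otimes> s' = s'"

text \<open>
  Between inverse monoids these are exactly the inverse monoid homomorphisms: compatibility with
  weak inverses follows from their uniqueness.
\<close>
definition monoid_hom :: "('a, 'm) monoid_scheme \<Rightarrow> ('b, 'n) monoid_scheme \<Rightarrow> ('a \<Rightarrow> 'b) set" where
  "monoid_hom G H = {h \<in> hom G H. h \<one>\<^bsub>G\<^esub> = \<one>\<^bsub>H\<^esub>}"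

definition canonical_preorder :: "('a, 'm) monoid_scheme \<Rightarrow> ('a \<times> 'a) set" where
  "canonical_preorder G =
    {(\<alpha>, \<beta>). \<alpha> \<in> carrier G \<and> \<beta> \<in> carrier G \<and> (\<exists>\<gamma>\<in>carrier G. \<alpha> \<otimes>\<^bsub>G\<^esub> \<gamma> = \<beta>)}"


section \<open>Stationarily measurable spaces\<close>

text \<open>
  Of the component \<open>meas\<close> only \<^term>\<open>space\<close> and \<^term>\<open>sets\<close> are used; the measure it
  carries plays no role.
\<close>
record ('x, 's) stat_space =
  meas :: "'x measure"
  monoid_of :: "'s monoid"
  act :: "'s \<Rightarrow> 'x \<Rightarrow> 'x"

locale stat_meas_space =
  fixes \<X> :: "('x, 's) stat_space"
  assumes inverse_monoid: "inverse_monoid (monoid_of \<X>)"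
    and act_one: "x \<in> space (meas \<X>) \<Longrightarrow> act \<X> \<one>\<^bsub>monoid_of \<X>\<^esub> x = x"
    and act_mult: "s \<in> carrier (monoid_of \<X>) \<Longrightarrow> t \<in> carrier (monoid_of \<X>) \<Longrightarrow> x \<in> space (meas \<X>) \<Longrightarrow>
      act \<X> (s \<otimes>\<^bsub>monoid_of \<X>\<^esub> t) x = act \<X> s (act \<X> t x)"
    and act_measurable: "s \<in> carrier (monoid_of \<X>) \<Longrightarrow> act \<X> s \<in> meas \<X> \<rightarrow>\<^sub>M meas \<X>"

definition preim :: "('x, 's) stat_space \<Rightarrow> 's \<Rightarrow> 'x set \<Rightarrow> 'x set" where
  "preim \<X> s A = act \<X> s -` A \<inter> space (meas \<X>)"

definition morph_preim :: "('x, 's) stat_space \<Rightarrow> ('x \<Rightarrow> 'y) \<Rightarrow> 'y set \<Rightarrow> 'x set" where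
  "morph_preim \<X> f B = f -` B \<inter> space (meas \<X>)"

definition stat_morphism ::
    "('x, 's) stat_space \<Rightarrow> ('y, 't) stat_space \<Rightarrow> ('x \<Rightarrow> 'y) \<Rightarrow> bool" where
  "stat_morphism \<X> \<Y> f \<longleftrightarrow>
    stat_meas_space \<X> \<and> stat_meas_space \<Y> \<and> f \<in> meas \<X> \<rightarrow>\<^sub>M meas \<Y> \<and>
    (\<exists>h \<in> monoid_hom (monoid_of \<Y>) (monoid_of \<X>).
      \<forall>t \<in> carrier (monoid_of \<Y>). \<forall>B \<in> sets (meas \<Y>).
        morph_preim \<X> f (preim \<Y> t B) = preim \<X> (h t) (morph_preim \<X> f B))"


section \<open>Countable coproducts of measurable sets\<close>

text \<open>
  The coproduct of the \<open>P j\<close>, i.e. the set \<open>\<Union>j. P j \<times> {j}\<close>, is represented by the sequence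
  \<open>P\<close> of its sections. Finite and other countable index sets are covered by reindexing
  and padding with the empty set. The elements of the closure of the \<open>\<sigma>\<close>-algebra under countable
  coproducts are the members of \<open>coprods \<X>\<close>, with equality given by the
  relation \<open>same_coprod \<X>\<close>.
\<close>
definition coprods :: "('x, 's) stat_space \<Rightarrow> (nat \<Rightarrow> 'x set) set" where
  "coprods \<X> = {P. \<forall>j. P j \<in> sets (meas \<X>)}"

definition same_coprod :: "('x, 's) stat_space \<Rightarrow> ((nat \<Rightarrow> 'x set) \<times> (nat \<Rightarrow> 'x set)) set" where
  "same_coprod \<X> = {(P, Q). P \<in> coprods \<X> \<and> Q \<in> coprods \<X> \<and>
    (\<exists>R. (\<forall>j k. R j k \<in> sets (meas \<X>)) \<and>
         (\<forall>j. disjoint_family (\<lambda>k. R j k) \<and> P j = (\<Union>k. R j k)) \<and>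
         (\<forall>k. disjoint_family (\<lambda>j. R j k) \<and> Q k = (\<Union>j. R j k)))}"

definition single :: "'x set \<Rightarrow> nat \<Rightarrow> 'x set" where
  "single A = (\<lambda>j. if j = 0 then A else {})"

definition coprod2 :: "(nat \<Rightarrow> 'x set) \<Rightarrow> (nat \<Rightarrow> 'x set) \<Rightarrow> nat \<Rightarrow> 'x set" where
  "coprod2 P Q = (\<lambda>n. case sum_decode n of Inl i \<Rightarrow> P i | Inr j \<Rightarrow> Q j)"

definition Coprod :: "(nat \<Rightarrow> nat \<Rightarrow> 'x set) \<Rightarrow> nat \<Rightarrow> 'x set" where
  "Coprod P = (\<lambda>n. case prod_decode n of (i, j) \<Rightarrow> P i j)"

definition coprod_preim :: "('x, 's) stat_space \<Rightarrow> 's \<Rightarrow> (nat \<Rightarrow> 'x set) \<Rightarrow> nat \<Rightarrow> 'x set" where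
  "coprod_preim \<X> s P = (\<lambda>j. preim \<X> s (P j))"

definition coprod_morph_preim ::
    "('x, 's) stat_space \<Rightarrow> ('x \<Rightarrow> 'y) \<Rightarrow> (nat \<Rightarrow> 'y set) \<Rightarrow> nat \<Rightarrow> 'x set" where
  "coprod_morph_preim \<X> f P = (\<lambda>j. morph_preim \<X> f (P j))"


section \<open>The type monoid\<close>

text \<open>
  Countable collections are sequences here; shorter ones are padded with empty coproducts and the
  unit of the monoid.
\<close>
definition equidec :: "('x, 's) stat_space \<Rightarrow> ((nat \<Rightarrow> 'x set) \<times> (nat \<Rightarrow> 'x set)) set" where
  "equidec \<X> = {(P, Q). P \<in> coprods \<X> \<and> Q \<in> coprods \<X> \<and>
    (\<exists>Ps Qs s t.
      (\<forall>j. Ps j \<in> coprods \<X> \<and> Qs j \<in> coprods \<X> \<and> s j \<in> carrier (monoid_of \<X>) \<and> t j \<in> carrier (monoid_of \<X>)) \<and>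
      (P, Coprod Ps) \<in> same_coprod \<X> \<and>
      (Q, Coprod Qs) \<in> same_coprod \<X> \<and>
      (\<forall>j. (coprod_preim \<X> (s j) (Ps j), coprod_preim \<X> (t j) (Qs j)) \<in> same_coprod \<X>))}"

definition equidec_class :: "('x, 's) stat_space \<Rightarrow> (nat \<Rightarrow> 'x set) \<Rightarrow> (nat \<Rightarrow> 'x set) set" where
  "equidec_class \<X> P = equidec \<X> `` {P}"

text \<open>
  Operations on classes are unions over all choices of representatives, which is a single class
  as soon as the operation is well defined.
\<close>
definition type_monoid :: "('x, 's) stat_space \<Rightarrow> (nat \<Rightarrow> 'x set) set monoid" where
  "type_monoid \<X> =
    \<lparr>carrier = coprods \<X> // equidec \<X>,
     monoid.mult = (\<lambda>\<alpha> \<beta>. \<Union>P\<in>\<alpha>. \<Union>Q\<in>\<beta>. equidec_class \<X> (coprod2 P Q)),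
     one = equidec_class \<X> (single {})\<rparr>"

definition type_sum ::
    "('x, 's) stat_space \<Rightarrow> (nat \<Rightarrow> (nat \<Rightarrow> 'x set) set) \<Rightarrow> (nat \<Rightarrow> 'x set) set" where
  "type_sum \<X> a = (\<Union>P\<in>{P. \<forall>i. P i \<in> a i}. equidec_class \<X> (Coprod P))"

definition type_map ::
    "('x, 's) stat_space \<Rightarrow> ('y, 't) stat_space \<Rightarrow> ('x \<Rightarrow> 'y) \<Rightarrow>
      (nat \<Rightarrow> 'y set) set \<Rightarrow> (nat \<Rightarrow> 'x set) set" where
  "type_map \<X> \<Y> f \<beta> = (\<Union>B\<in>\<beta>. equidec_class \<X> (coprod_morph_preim \<X> f B))"

definition tarski_measure :: "('x, 's) stat_space \<Rightarrow> 'x set \<Rightarrow> (nat \<Rightarrow> 'x set) set" where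
  "tarski_measure \<X> A = equidec_class \<X> (single A)"

end

theory Submission
  imports Defs
begin

text \<open>
  A coproduct \<open>P\<close> is determined, up to the identification of equal coproducts, by the function counting
  the points over each \<open>x\<close>, i.e. the \<open>j\<close> with \<open>x \<in> P j\<close>: equal counts let one match the two fibres in
  the order of their indices, and this matching is measurable (\<open>same_coprod_iff\<close>). Coproducts therefore
  become measurable functions with values in the natural numbers and \<open>\<infinity>\<close>, sums of coproducts become
  pointwise sums, and preimages become compositions. The commutative monoid laws are then pointwise
  identities.

  The central point is that an equidecomposition of \<open>\<phi>\<close> with \<open>\<Sum>k. \<Psi> k\<close> splits \<open>\<phi>\<close> into pieces
  equidecomposable with the \<open>\<Psi> k\<close> (\<open>fun_equidec_split\<close>). Since the action of \<open>s\<close> is not invertible, pulling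
  the pieces \<open>\<Psi> k\<close> back along a weak inverse \<open>s'\<close> of \<open>s\<close> reconstructs only the composition of \<open>\<phi>\<close> with
  \<open>s s'\<close>. The part of \<open>\<phi>\<close> where this differs from \<open>\<phi>\<close> is invisible after a further pullback along \<open>s\<close>,
  because \<open>s s' s = s\<close>; it can be added to any piece (\<open>elem_equidec_split\<close>). Splitting, together
  with the fact that idempotents of an inverse monoid commute, makes equidecomposability transitive.

  Splitting also turns an equation between types into an equation between functions, where
  refinement of equal sums and limits of decreasing sequences can be computed pointwise. So the type
  monoid is a cardinal algebra in the sense of Tarski, and two facts about all cardinal algebras finish
  the proof of the algebraic claims: the canonical preorder is antisymmetric (\<open>le_antisym\<close>, the
  Schroeder-Bernstein argument) and \<open>n a = n b\<close> implies \<open>a = b\<close> (\<open>pow_cancel\<close>). For the latter, remove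
  again and again a common part \<open>e\<close> from \<open>a\<close> and \<open>b\<close> that is so large that what remains of them is at most
  \<open>n e\<close>, up to summands already absorbed by the multiples removed so far. In the limit both \<open>a\<close> and \<open>b\<close>
  are equal to the sum of the common parts, because the remainders lie below \<open>n e\<close> for
  every one of the infinitely many \<open>e\<close>.

  Morphisms pull back functions and their equidecompositions, so they act on types, compatibly with
  sums and with the classes of single sets.
\<close>


section \<open>Cancellation in cardinal algebras\<close>

lemma dependent_choice_from:
  assumes "P x" "\<And>y. P y \<Longrightarrow> \<exists>z. P z \<and> R y z"
  shows "\<exists>f :: nat \<Rightarrow> 'a. f 0 = x \<and> (\<forall>n. P (f n)) \<and> (\<forall>n. R (f n) (f (Suc n)))"
proof -
  have "\<exists>f. \<forall>n. (P (f n) \<and> (n = 0 \<longrightarrow> f n = x)) \<and> R (f n) (f (Suc n))"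
    by (rule dependent_nat_choice) (use assms in auto)
  then show ?thesis
    by metis
qed

text \<open>
  The operation \<open>\<otimes>\<close> is to be thought of as addition and is written additively in the comments:
  \<open>n a\<close> is \<open>a [^] n\<close>, and \<open>Sig\<close> is the sum of a sequence. The last assumption says that a
  sequence which loses \<open>g n\<close> at step \<open>n\<close> has a limit \<open>c\<close>, and that nothing else is lost on the way.
  An element \<open>h\<close> is said to absorb \<open>p\<close> if \<open>h \<otimes> p = h\<close>.
\<close>
locale cardinal_algebra = comm_monoid G for G (structure) +
  fixes Sig :: "(nat \<Rightarrow> 'a) \<Rightarrow> 'a"
  assumes Sig_closed [intro, simp]: "(\<And>i. f i \<in> carrier G) \<Longrightarrow> Sig f \<in> carrier G"
    and Sig_Suc: "(\<And>i. f i \<in> carrier G) \<Longrightarrow> Sig f = f 0 \<otimes> Sig (\<lambda>i. f (Suc i))"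
    and Sig_mult: "(\<And>i. f i \<in> carrier G) \<Longrightarrow> (\<And>i. g i \<in> carrier G) \<Longrightarrow>
      Sig (\<lambda>i. f i \<otimes> g i) = Sig f \<otimes> Sig g"
    and refinement: "\<lbrakk>a \<in> carrier G; b \<in> carrier G; c \<in> carrier G; d \<in> carrier G;
        a \<otimes> b = c \<otimes> d\<rbrakk> \<Longrightarrow>
      \<exists>p\<in>carrier G. \<exists>q\<in>carrier G. \<exists>r\<in>carrier G. \<exists>s\<in>carrier G.
        a = p \<otimes> q \<and> b = r \<otimes> s \<and> c = p \<otimes> r \<and> d = q \<otimes> s"
    and remainder: "\<lbrakk>\<And>n. f n \<in> carrier G; \<And>n. g n \<in> carrier G;
        \<And>n. f n = g n \<otimes> f (Suc n)\<rbrakk> \<Longrightarrow>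
      \<exists>c\<in>carrier G. \<forall>n. f n = c \<otimes> Sig (\<lambda>i. g (n + i))"
begin

definition le :: "'a \<Rightarrow> 'a \<Rightarrow> bool" (infix "\<preceq>" 50) where
  "a \<preceq> b \<longleftrightarrow> (\<exists>c\<in>carrier G. a \<otimes> c = b)"

lemma leI: "a \<otimes> c = b \<Longrightarrow> c \<in> carrier G \<Longrightarrow> a \<preceq> b"
  unfolding le_def by blast

lemma leE:
  assumes "a \<preceq> b"
  obtains c where "c \<in> carrier G" "b = a \<otimes> c"
  using assms unfolding le_def by blast

lemma le_refl: "a \<in> carrier G \<Longrightarrow> a \<preceq> a"
  by (rule leI[of a \<one>]) auto

lemma le_trans:
  assumes "a \<in> carrier G" "a \<preceq> b" "b \<preceq> c"
  shows "a \<preceq> c"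
proof -
  obtain d e where "d \<in> carrier G" "b = a \<otimes> d" "e \<in> carrier G" "c = b \<otimes> e"
    using assms by (metis leE)
  then show ?thesis
    using assms(1) by (intro leI[of a "d \<otimes> e"]) (auto simp: m_assoc)
qed

lemma le_mult_left: "a \<in> carrier G \<Longrightarrow> b \<in> carrier G \<Longrightarrow> b \<preceq> a \<otimes> b"
  by (rule leI[of b a]) (auto simp: m_comm)

lemma le_mult_right: "a \<in> carrier G \<Longrightarrow> b \<in> carrier G \<Longrightarrow> a \<preceq> a \<otimes> b"
  by (rule leI[of a b]) auto

lemma le_mult_mono:
  assumes "a \<in> carrier G" "b \<in> carrier G" "a \<preceq> a'" "b \<preceq> b'"
  shows "a \<otimes> b \<preceq> a' \<otimes> b'"
proof -
  obtain c d where "c \<in> carrier G" "a' = a \<otimes> c" "d \<in> carrier G" "b' = b \<otimes> d"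
    using assms by (metis leE)
  then show ?thesis
    using assms(1,2) by (intro leI[of _ "c \<otimes> d"]) (auto simp: m_ac)
qed

lemma le_pow_mono:
  assumes "a \<in> carrier G" "a \<preceq> b"
  shows "a [^] (n::nat) \<preceq> b [^] n"
  by (induction n) (use assms in \<open>auto intro: le_refl le_mult_mono\<close>)

lemma le_pow_self:
  assumes "a \<in> carrier G" "1 \<le> (n::nat)"
  shows "a \<preceq> a [^] n"
proof -
  obtain m where "n = Suc m"
    using assms(2) by (cases n) auto
  then show ?thesis
    using assms(1) by (auto intro: le_mult_left)
qed

lemma le_Sig_mono:
  assumes "\<And>i. a i \<in> carrier G" "\<And>i. a i \<preceq> b i"
  shows "Sig a \<preceq> Sig b"
proof -
  have "\<forall>i. \<exists>c. c \<in> carrier G \<and> b i = a i \<otimes> c"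
    using assms(2) by (metis leE)
  then obtain c where c: "\<And>i. c i \<in> carrier G" "\<And>i. b i = a i \<otimes> c i"
    by metis
  have "b = (\<lambda>i. a i \<otimes> c i)"
    using c(2) by blast
  then have "Sig b = Sig a \<otimes> Sig c"
    using assms(1) c(1) by (simp add: Sig_mult)
  then show ?thesis
    using c(1) by (intro leI[of _ "Sig c"]) auto
qed

lemma remainder_first:
  assumes "\<And>n. f n \<in> carrier G" "\<And>n. g n \<in> carrier G" "\<And>n. f n = g n \<otimes> f (Suc n)"
  obtains c where "c \<in> carrier G" "f 0 = c \<otimes> Sig g"
proof -
  obtain c where "c \<in> carrier G" "\<forall>n. f n = c \<otimes> Sig (\<lambda>i. g (n + i))"
    using remainder[of f g, OF assms] by blast
  then show thesis
    using that[of c] by (auto dest: spec[of _ 0])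
qed

lemma absorb_remainder:
  assumes "h \<in> carrier G" "\<And>n. p n \<in> carrier G" "\<And>n. h \<otimes> p n = h"
  obtains c where "c \<in> carrier G" "h = c \<otimes> Sig p"
proof -
  have "h = p n \<otimes> h" for n
    using assms m_comm[of h "p n"] by simp
  with assms(1,2) show thesis
    by (rule remainder_first[of "\<lambda>_. h" p]) (use that in auto)
qed

text \<open>
  By the remainder axiom \<open>h = k + p + p + \<dots>\<close>, and infinitely many copies of a part \<open>q\<close> of \<open>p\<close> have room
  for one more.
\<close>
lemma absorb_le:
  assumes "h \<in> carrier G" "p \<in> carrier G" "q \<in> carrier G" "h \<otimes> p = h" "q \<preceq> p"
  shows "h \<otimes> q = h"
proof -
  obtain r where r: "r \<in> carrier G" "p = q \<otimes> r"
    using assms(5) by (rule leE)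
  obtain k where k: "k \<in> carrier G" "h = k \<otimes> Sig (\<lambda>_. p)"
    by (rule absorb_remainder[of h "\<lambda>_. p"]) (use assms in auto)
  define Q R where "Q = Sig (\<lambda>_. q)" "R = Sig (\<lambda>_. r)"
  have QR: "Q \<in> carrier G" "R \<in> carrier G"
    unfolding Q_R_def using assms r by auto
  have h: "h = k \<otimes> (Q \<otimes> R)"
    using k r assms unfolding Q_R_def by (simp add: Sig_mult)
  have Q: "Q = q \<otimes> Q"
    unfolding Q_R_def using assms Sig_Suc[of "\<lambda>_. q"] by simp
  have "h \<otimes> q = k \<otimes> ((q \<otimes> Q) \<otimes> R)"
    unfolding h using k(1) QR assms(3) by (simp add: m_ac)
  then show ?thesis
    using h Q by simp
qed

text \<open>
  The Schroeder-Bernstein argument: \<open>b = a + c\<close> and \<open>a = b + d\<close> make \<open>a\<close> absorb \<open>c + d\<close>, hence its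
  part \<open>c\<close>.
\<close>
lemma le_antisym:
  assumes "a \<in> carrier G" "b \<in> carrier G" "a \<preceq> b" "b \<preceq> a"
  shows "a = b"
proof -
  obtain c d where c: "c \<in> carrier G" "b = a \<otimes> c" and d: "d \<in> carrier G" "a = b \<otimes> d"
    using assms by (metis leE)
  have "a \<otimes> (c \<otimes> d) = a"
    using c d assms(1) m_assoc by metis
  then have "a \<otimes> c = a"
    using c(1) d(1) assms(1) by (intro absorb_le[of a "c \<otimes> d" c]) (auto intro: le_mult_right)
  then show ?thesis
    using c(2) by simp
qed

lemma absorb_mono:
  assumes "h \<in> carrier G" "p \<in> carrier G" "h \<otimes> p = h" "h \<preceq> k"
  shows "k \<otimes> p = k"
proof -
  obtain r where "r \<in> carrier G" "k = h \<otimes> r"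
    using assms(4) by (rule leE)
  then show ?thesis
    using assms by (metis m_assoc m_comm)
qed

lemma absorb_mult:
  assumes "h \<in> carrier G" "p \<in> carrier G" "q \<in> carrier G" "h \<otimes> p = h" "h \<otimes> q = h"
  shows "h \<otimes> (p \<otimes> q) = h"
  using assms by (metis m_assoc)

lemma absorb_pow:
  assumes "h \<in> carrier G" "p \<in> carrier G" "h \<otimes> p = h"
  shows "h \<otimes> p [^] (n::nat) = h"
  by (induction n) (use assms in \<open>auto intro: absorb_mult\<close>)

lemma const_Sig_absorb:
  assumes "p \<in> carrier G"
  shows "Sig (\<lambda>_. p) \<otimes> p = Sig (\<lambda>_. p)"
  using assms Sig_Suc[of "\<lambda>_. p"] by (simp add: m_comm)

text \<open>
  The sum of infinitely many \<open>p\<close> absorbs \<open>p + p\<close>, so it lies above the sum of infinitely many \<open>p + p\<close>,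
  which is its own double.
\<close>
lemma const_Sig_double:
  assumes p: "p \<in> carrier G"
  shows "Sig (\<lambda>_. p) \<otimes> Sig (\<lambda>_. p) = Sig (\<lambda>_. p)"
proof (rule le_antisym)
  let ?h = "Sig (\<lambda>_. p)"
  have "?h \<otimes> (p \<otimes> p) = ?h"
    using p const_Sig_absorb[OF p] by (intro absorb_mult) auto
  then obtain c where c: "c \<in> carrier G" "?h = c \<otimes> Sig (\<lambda>_. p \<otimes> p)"
    using p by (auto intro: absorb_remainder[of ?h "\<lambda>_. p \<otimes> p"])
  have "Sig (\<lambda>_. p \<otimes> p) = ?h \<otimes> ?h"
    using p by (simp add: Sig_mult)
  with c p show "?h \<otimes> ?h \<preceq> ?h"
    by (metis Sig_closed le_mult_left m_closed)
qed (use p in \<open>auto intro: le_mult_right\<close>)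

lemma absorb_const_Sig:
  assumes "h \<in> carrier G" "p \<in> carrier G" "h \<otimes> p = h"
  shows "h \<otimes> Sig (\<lambda>_. p) = h"
proof -
  obtain c where c: "c \<in> carrier G" "h = c \<otimes> Sig (\<lambda>_. p)"
    by (rule absorb_remainder[of h "\<lambda>_. p"]) (use assms in auto)
  then show ?thesis
    using assms(2) const_Sig_double[OF assms(2)] by (metis Sig_closed m_assoc)
qed

text \<open>
  Each \<open>p n\<close> may be replaced by the sum \<open>q n\<close> of infinitely many copies of it, which \<open>h\<close> absorbs as well.
  The remainder axiom places all \<open>q n\<close> side by side inside \<open>h\<close>, and there each has room for another \<open>p n\<close>.
\<close>
lemma absorb_Sig:
  assumes "h \<in> carrier G" "\<And>n. p n \<in> carrier G" "\<And>n. h \<otimes> p n = h"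
  shows "h \<otimes> Sig p = h"
proof -
  define q where "q n = Sig (\<lambda>_. p n)" for n
  have q: "q n \<in> carrier G" "h \<otimes> q n = h" "q n \<otimes> p n = q n" for n
    unfolding q_def using assms by (auto intro: absorb_const_Sig const_Sig_absorb)
  obtain c where c: "c \<in> carrier G" "h = c \<otimes> Sig q"
    by (rule absorb_remainder[of h q]) (use assms(1) q in auto)
  have "Sig q \<otimes> Sig p = Sig q"
    using Sig_mult[of q p] q assms(2) by simp
  then show ?thesis
    using c(1) q(1) assms(2) by (subst (1 2) c(2)) (simp add: m_assoc)
qed

text \<open>
  Cancellation of \<open>c\<close> is possible up to summands that \<open>c\<close> absorbs. Refining \<open>a + c = b + c\<close> gives
  \<open>a = p + q\<close>, \<open>b = p + r\<close> and \<open>c = r + s = q + s\<close>, so that \<open>(q, r, s)\<close> is a triple like \<open>(a, b, c)\<close>.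
  Repeat this forever. By the remainder axiom \<open>a\<close> and \<open>b\<close> are the sum of the common parts \<open>p\<close> plus limits
  \<open>u\<close> and \<open>v\<close>. The limit \<open>u\<close> lies below every \<open>q\<close>, and \<open>c\<close> contains the sum of all \<open>q\<close>; hence \<open>c\<close> contains
  infinitely many copies of \<open>u\<close> and absorbs it. The same holds for \<open>v\<close>.
\<close>
lemma cancel_mod_absorbed:
  assumes "a \<in> carrier G" "b \<in> carrier G" "c \<in> carrier G" "a \<otimes> c = b \<otimes> c"
  obtains d u v where "d \<in> carrier G" "u \<in> carrier G" "v \<in> carrier G"
    "a = d \<otimes> u" "b = d \<otimes> v" "c \<otimes> u = c" "c \<otimes> v = c"
proof -
  define ok where "ok = (\<lambda>(x, y, z). x \<in> carrier G \<and> y \<in> carrier G \<and> z \<in> carrier G \<and>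
    x \<otimes> z = y \<otimes> z)"
  define next_to where "next_to = (\<lambda>(x, y, z) (x', y', z').
    (\<exists>d\<in>carrier G. x = d \<otimes> x' \<and> y = d \<otimes> y') \<and> z = x' \<otimes> z' \<and> z = y' \<otimes> z')"
  have "\<exists>t'. ok t' \<and> next_to t t'" if "ok t" for t
  proof -
    obtain x y z where t: "t = (x, y, z)"
      by (cases t)
    then have "x \<in> carrier G" "y \<in> carrier G" "z \<in> carrier G" "x \<otimes> z = y \<otimes> z"
      using that unfolding ok_def by auto
    from refinement[OF this(1,3,2,3,4)]
    obtain p q r s where *: "p \<in> carrier G" "q \<in> carrier G" "r \<in> carrier G" "s \<in> carrier G"
      "x = p \<otimes> q" "z = r \<otimes> s" "y = p \<otimes> r" "z = q \<otimes> s"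
      by blast
    then have "ok (q, r, s)" "next_to t (q, r, s)"
      unfolding ok_def next_to_def t by auto
    then show ?thesis
      by blast
  qed
  then have next_ok: "\<And>t. ok t \<Longrightarrow> \<exists>t'. ok t' \<and> next_to t t'"
    by blast
  have start: "ok (a, b, c)"
    unfolding ok_def using assms by auto
  obtain t where t: "t 0 = (a, b, c)" "\<And>n. ok (t n)" "\<And>n. next_to (t n) (t (Suc n))"
    using dependent_choice_from[of ok _ next_to, OF start next_ok] by blast
  define x y z where "x n = fst (t n)" "y n = fst (snd (t n))" "z n = snd (snd (t n))" for n
  have xyz: "x n \<in> carrier G" "y n \<in> carrier G" "z n \<in> carrier G" "x 0 = a" "y 0 = b" "z 0 = c"
    "z n = x (Suc n) \<otimes> z (Suc n)" "z n = y (Suc n) \<otimes> z (Suc n)"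
    "\<exists>d\<in>carrier G. x n = d \<otimes> x (Suc n) \<and> y n = d \<otimes> y (Suc n)" for n
    using t(1) t(2)[of n] t(3)[of n] unfolding ok_def next_to_def x_y_z_def by auto
  from xyz(9) obtain d where d: "\<And>n. d n \<in> carrier G" "\<And>n. x n = d n \<otimes> x (Suc n)"
    "\<And>n. y n = d n \<otimes> y (Suc n)"
    by metis
  have absorbed: "c \<otimes> u = c" if w: "\<And>n. w n \<in> carrier G" "\<And>n. z n = w (Suc n) \<otimes> z (Suc n)"
    and u: "u \<in> carrier G" "\<And>n. w n = u \<otimes> Sig (\<lambda>i. d (n + i))" for w u
  proof -
    obtain k where k: "k \<in> carrier G" "c = k \<otimes> Sig (\<lambda>n. w (Suc n))"
      by (rule remainder_first[of z "\<lambda>n. w (Suc n)"]) (use xyz(3,6) w in fast)+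
    have "Sig (\<lambda>_. u) \<preceq> Sig (\<lambda>n. w (Suc n))"
    proof (rule le_Sig_mono)
      show "u \<preceq> w (Suc n)" for n
        using u d(1) by (subst u(2)) (auto intro: le_mult_right)
    qed (use u in auto)
    also have "Sig (\<lambda>n. w (Suc n)) \<preceq> c"
      unfolding k(2) using k(1) w(1) by (auto intro: le_mult_left)
    finally (le_trans[rotated]) have "Sig (\<lambda>_. u) \<preceq> c"
      using u by auto
    then show ?thesis
      using u by (intro absorb_mono[OF _ _ const_Sig_absorb]) auto
  qed
  obtain u where u: "u \<in> carrier G" "\<And>n. x n = u \<otimes> Sig (\<lambda>i. d (n + i))"
    using remainder[of x d] xyz(1) d by blast
  obtain v where v: "v \<in> carrier G" "\<And>n. y n = v \<otimes> Sig (\<lambda>i. d (n + i))"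
    using remainder[of y d] xyz(2) d by blast
  show thesis
  proof (rule that[of "Sig d" u v])
    show "a = Sig d \<otimes> u"
      using u(2)[of 0] xyz(4) u(1) d(1) by (simp add: m_comm)
    show "b = Sig d \<otimes> v"
      using v(2)[of 0] xyz(5) v(1) d(1) by (simp add: m_comm)
    show "c \<otimes> u = c"
      using absorbed[OF xyz(1) xyz(7) u] .
    show "c \<otimes> v = c"
      using absorbed[OF xyz(2) xyz(8) v] .
  qed (use d u v in auto)
qed

text \<open>
  Cancel \<open>n c\<close> from \<open>n c + (c + e) = n c + c\<close>: this gives \<open>c + e = d + u\<close> and \<open>c = d + v\<close>, where \<open>n c\<close>, and by
  induction \<open>c\<close>, absorbs \<open>u\<close>. Then \<open>c + e\<close> lies below \<open>c + e + v = c + u = c\<close>.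
\<close>
lemma absorb_if_pow_absorbs:
  assumes "c \<in> carrier G" "1 \<le> (n::nat)" "e \<in> carrier G" "c [^] n \<otimes> e = c [^] n"
  shows "c \<otimes> e = c"
  using assms(2,3,4)
proof (induction n arbitrary: e rule: nat_induct_at_least)
  case base
  then show ?case
    using assms(1) by simp
next
  case (Suc n)
  note c = assms(1)
  have eq: "(c \<otimes> e) \<otimes> c [^] n = c \<otimes> c [^] n"
    using Suc.prems c by (simp add: m_ac)
  obtain d u v where duv: "d \<in> carrier G" "u \<in> carrier G" "v \<in> carrier G"
    "c \<otimes> e = d \<otimes> u" "c = d \<otimes> v" "c [^] n \<otimes> u = c [^] n" "c [^] n \<otimes> v = c [^] n"
    by (rule cancel_mod_absorbed[OF _ c _ eq]) (use c Suc.prems(1) in auto)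
  have "(c \<otimes> e) \<otimes> v = c \<otimes> u"
    using duv by (metis m_assoc m_comm)
  also have "\<dots> = c"
    using Suc.IH duv by blast
  finally have "c \<otimes> e \<preceq> c"
    using duv by (intro leI)
  then show ?case
    using c Suc.prems by (intro le_antisym) (auto intro: le_mult_right)
qed

lemma le_multE:
  assumes "x \<in> carrier G" "a \<in> carrier G" "b \<in> carrier G" "x \<preceq> a \<otimes> b"
  obtains y z where "y \<in> carrier G" "z \<in> carrier G" "x = y \<otimes> z" "y \<preceq> a" "z \<preceq> b"
proof -
  obtain w where "w \<in> carrier G" "x \<otimes> w = a \<otimes> b"
    using assms(4) by (metis leE)
  from refinement[OF assms(1) this(1) assms(2,3) this(2)] that show thesis
    by (metis le_mult_right)
qed

text \<open>
  An element below \<open>m a\<close> has a part in common with \<open>a\<close> that is large compared with what is left. Write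
  \<open>x\<close> as a sum of \<open>m\<close> elements below \<open>a\<close> and place them into \<open>a\<close> one after the other; what
  does not fit of an element lies below the part \<open>e\<close> of \<open>a\<close> that is already occupied.
\<close>
lemma common_part:
  assumes "a \<in> carrier G" "x \<in> carrier G" "x \<preceq> a [^] (m::nat)"
  shows "\<exists>e\<in>carrier G. \<exists>f\<in>carrier G. \<exists>g\<in>carrier G. x = e \<otimes> f \<and> a = e \<otimes> g \<and> f \<preceq> e [^] m"
  using assms(2,3)
proof (induction m arbitrary: x)
  case 0
  then show ?case
    using assms(1) by (intro bexI[of _ \<one>] bexI[of _ x] bexI[of _ a]) auto
next
  case (Suc m)
  obtain y z where yz: "y \<in> carrier G" "z \<in> carrier G" "x = y \<otimes> z" "y \<preceq> a [^] m" "z \<preceq> a"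
    using Suc.prems assms(1) by (auto elim: le_multE)
  obtain e f g where efg: "e \<in> carrier G" "f \<in> carrier G" "g \<in> carrier G"
    "y = e \<otimes> f" "a = e \<otimes> g" "f \<preceq> e [^] m"
    using Suc.IH[OF yz(1,4)] by blast
  obtain z1 z2 where z: "z1 \<in> carrier G" "z2 \<in> carrier G" "z = z1 \<otimes> z2" "z1 \<preceq> e" "z2 \<preceq> g"
    using yz(2,5) efg by (auto elim: le_multE)
  obtain h where h: "h \<in> carrier G" "g = z2 \<otimes> h"
    using z(5) by (rule leE)
  have "f \<otimes> z1 \<preceq> e [^] Suc m"
    using efg z by (auto intro: le_mult_mono)
  also have "e [^] Suc m \<preceq> (e \<otimes> z2) [^] Suc m"
    using efg z by (intro le_pow_mono) (auto intro: le_mult_right)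
  finally (le_trans[rotated]) have "f \<otimes> z1 \<preceq> (e \<otimes> z2) [^] Suc m"
    using efg z by auto
  moreover have "x = (e \<otimes> z2) \<otimes> (f \<otimes> z1)" "a = (e \<otimes> z2) \<otimes> h"
    using yz efg z h by (auto simp: m_ac)
  moreover have "e \<otimes> z2 \<in> carrier G" "f \<otimes> z1 \<in> carrier G"
    using efg z by auto
  ultimately show ?case
    using h(1) by blast
qed

text \<open>
  Cancelling \<open>c\<close> shows that \<open>b\<close> lies below \<open>n a + v\<close> with \<open>v\<close> absorbed by \<open>c\<close>. So, up to a summand \<open>q\<close>
  absorbed by \<open>c\<close>, it lies below \<open>n a\<close> and shares a large part \<open>e\<close> with \<open>a\<close>. Moving \<open>n e\<close> from the
  multiples of \<open>a\<close> and \<open>b\<close> to \<open>c\<close> restores an equation of the original form for the remainders.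
\<close>
lemma extract_common_part:
  assumes "a \<in> carrier G" "b \<in> carrier G" "c \<in> carrier G" "1 \<le> (n::nat)"
    "a [^] n \<otimes> c = b [^] n \<otimes> c"
  obtains e a' b' q where "e \<in> carrier G" "a' \<in> carrier G" "b' \<in> carrier G" "q \<in> carrier G"
    "a = e \<otimes> a'" "b = e \<otimes> b' \<otimes> q" "c \<otimes> q = c" "b' \<preceq> e [^] n"
    "a' [^] n \<otimes> (c \<otimes> e [^] n) = b' [^] n \<otimes> (c \<otimes> e [^] n)"
proof -
  obtain d u v where duv: "d \<in> carrier G" "u \<in> carrier G" "v \<in> carrier G"
    "a [^] n = d \<otimes> u" "b [^] n = d \<otimes> v" "c \<otimes> u = c" "c \<otimes> v = c"
    by (rule cancel_mod_absorbed[of "a [^] n" "b [^] n" c]) (use assms that in auto)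
  have "b \<preceq> d \<otimes> v"
    using assms le_pow_self duv by metis
  also have "d \<otimes> v \<preceq> a [^] n \<otimes> v"
    using duv by (auto intro!: le_mult_mono le_mult_right le_refl)
  finally (le_trans[rotated]) have le: "b \<preceq> a [^] n \<otimes> v"
    using assms by blast
  obtain x q where xq: "x \<in> carrier G" "q \<in> carrier G" "b = x \<otimes> q" "x \<preceq> a [^] n" "q \<preceq> v"
    by (rule le_multE[OF assms(2) nat_pow_closed[OF assms(1)] duv(3) le])
  obtain e f g where efg: "e \<in> carrier G" "f \<in> carrier G" "g \<in> carrier G"
    "x = e \<otimes> f" "a = e \<otimes> g" "f \<preceq> e [^] n"
    using common_part[OF assms(1) xq(1,4)] by blast
  have cq: "c \<otimes> q = c"
    using absorb_le[OF assms(3) duv(3) xq(2) duv(7) xq(5)] .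
  show thesis
  proof (rule that[of e g f q])
    have "g [^] n \<otimes> (c \<otimes> e [^] n) = a [^] n \<otimes> c"
      using efg assms(3) by (simp add: nat_pow_distrib m_ac)
    also have "\<dots> = b [^] n \<otimes> c"
      by (rule assms(5))
    also have "\<dots> = f [^] n \<otimes> ((c \<otimes> q [^] n) \<otimes> e [^] n)"
      using efg xq assms(3) by (simp add: nat_pow_distrib m_ac)
    also have "c \<otimes> q [^] n = c"
      using absorb_pow[OF assms(3) xq(2) cq] .
    finally show "g [^] n \<otimes> (c \<otimes> e [^] n) = f [^] n \<otimes> (c \<otimes> e [^] n)" .
  qed (use efg xq cq in auto)
qed

text \<open>
  The previous extraction bounds only the remainder of \<open>b\<close>. A second one with exchanged roles bounds
  the remainder of \<open>a\<close>, too, and keeps the bound for \<open>b\<close>.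
\<close>
lemma extract_large_common_part:
  assumes "a \<in> carrier G" "b \<in> carrier G" "c \<in> carrier G" "1 \<le> (n::nat)"
    "a [^] n \<otimes> c = b [^] n \<otimes> c"
  obtains e a' b' p q where "e \<in> carrier G" "a' \<in> carrier G" "b' \<in> carrier G" "p \<in> carrier G"
    "q \<in> carrier G" "a = (e \<otimes> p) \<otimes> a'" "b = (e \<otimes> q) \<otimes> b'"
    "(c \<otimes> e [^] n) \<otimes> p = c \<otimes> e [^] n" "(c \<otimes> e [^] n) \<otimes> q = c \<otimes> e [^] n"
    "a' \<preceq> e [^] n" "b' \<preceq> e [^] n"
    "a' [^] n \<otimes> (c \<otimes> e [^] n) = b' [^] n \<otimes> (c \<otimes> e [^] n)"
proof -
  obtain e a1 b1 q where 1: "e \<in> carrier G" "a1 \<in> carrier G" "b1 \<in> carrier G" "q \<in> carrier G"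
    "a = e \<otimes> a1" "b = e \<otimes> b1 \<otimes> q" "c \<otimes> q = c" "b1 \<preceq> e [^] n"
    "a1 [^] n \<otimes> (c \<otimes> e [^] n) = b1 [^] n \<otimes> (c \<otimes> e [^] n)"
    by (rule extract_common_part[OF assms])
  obtain e' a2 b2 p where 2: "e' \<in> carrier G" "a2 \<in> carrier G" "b2 \<in> carrier G" "p \<in> carrier G"
    "b1 = e' \<otimes> b2" "a1 = e' \<otimes> a2 \<otimes> p" "(c \<otimes> e [^] n) \<otimes> p = c \<otimes> e [^] n" "a2 \<preceq> e' [^] n"
    "b2 [^] n \<otimes> ((c \<otimes> e [^] n) \<otimes> e' [^] n) = a2 [^] n \<otimes> ((c \<otimes> e [^] n) \<otimes> e' [^] n)"
    by (rule extract_common_part[OF 1(3,2) _ assms(4) 1(9)[symmetric]]) (use 1(1) assms(3) in auto)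
  have E: "c \<otimes> (e \<otimes> e') [^] n = (c \<otimes> e [^] n) \<otimes> e' [^] n"
    using 1 2 assms(3) by (simp add: nat_pow_distrib m_ac)
  show thesis
  proof (rule that[of "e \<otimes> e'" a2 b2 p q])
    show "(c \<otimes> (e \<otimes> e') [^] n) \<otimes> p = c \<otimes> (e \<otimes> e') [^] n"
      unfolding E using 1 2 assms by (intro absorb_mono[OF _ _ 2(7)] le_mult_right) auto
    show "(c \<otimes> (e \<otimes> e') [^] n) \<otimes> q = c \<otimes> (e \<otimes> e') [^] n"
      using 1 2 assms by (intro absorb_mono[OF _ _ 1(7)] le_mult_right) auto
    show "a2 \<preceq> (e \<otimes> e') [^] n"
      using 1 2 by (intro le_trans[OF _ 2(8)] le_pow_mono le_mult_left) auto
    have "b2 \<preceq> b1"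
      using 2 by (auto intro: le_mult_left)
    then have "b2 \<preceq> e [^] n"
      using 1 2 le_trans by blast
    then show "b2 \<preceq> (e \<otimes> e') [^] n"
      using 1 2 by (elim le_trans[rotated]) (auto intro: le_pow_mono le_mult_right)
    show "a2 [^] n \<otimes> (c \<otimes> (e \<otimes> e') [^] n) = b2 [^] n \<otimes> (c \<otimes> (e \<otimes> e') [^] n)"
      using 2(9) E by simp
  qed (use 1 2 in \<open>auto simp: m_ac\<close>)
qed

text \<open>
  Extracting common parts \<open>e 0\<close>, \<open>e 1\<close>, \<open>\<dots>\<close> forever writes \<open>a\<close> as \<open>l + E + P\<close>, where \<open>E\<close> is the sum of
  all \<open>e i\<close>, \<open>P\<close> is the sum of the summands dropped on the way, and \<open>l\<close> is the limit of the remainders.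
  The summands of \<open>P\<close> are absorbed by finite sums of \<open>n (e i)\<close>, hence by \<open>n E\<close>. As \<open>l\<close> lies below
  each \<open>n (e i)\<close>, infinitely many copies of \<open>l\<close> fit into \<open>n E\<close>, which therefore absorbs \<open>l\<close>. So \<open>E\<close>
  absorbs both, and \<open>a = E\<close>; for the same reason \<open>b = E\<close>.
\<close>
theorem pow_cancel:
  assumes "a \<in> carrier G" "b \<in> carrier G" "1 \<le> (n::nat)" "a [^] n = b [^] n"
  shows "a = b"
proof -
  \<comment> \<open>\<open>x\<close> and \<open>y\<close> are what remains of \<open>a\<close> and \<open>b\<close>; \<open>z\<close> collects \<open>n\<close> copies of each part removed so far\<close>
  define ok where "ok = (\<lambda>(x, y, z). x \<in> carrier G \<and> y \<in> carrier G \<and> z \<in> carrier G \<and>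
    x [^] n \<otimes> z = y [^] n \<otimes> z)"
  define next_to where "next_to = (\<lambda>(x, y, z) (x', y', z').
    \<exists>e p q. e \<in> carrier G \<and> p \<in> carrier G \<and> q \<in> carrier G \<and> z' = z \<otimes> e [^] n \<and>
      x = (e \<otimes> p) \<otimes> x' \<and> y = (e \<otimes> q) \<otimes> y' \<and> z' \<otimes> p = z' \<and> z' \<otimes> q = z' \<and>
      x' \<preceq> e [^] n \<and> y' \<preceq> e [^] n)"
  have "\<exists>t'. ok t' \<and> next_to t t'" if "ok t" for t
  proof -
    obtain x y z where t: "t = (x, y, z)"
      by (cases t)
    then have xyz: "x \<in> carrier G" "y \<in> carrier G" "z \<in> carrier G" "x [^] n \<otimes> z = y [^] n \<otimes> z"
      using that unfolding ok_def by auto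
    obtain e x' y' p q where *: "e \<in> carrier G" "x' \<in> carrier G" "y' \<in> carrier G" "p \<in> carrier G"
      "q \<in> carrier G" "x = (e \<otimes> p) \<otimes> x'" "y = (e \<otimes> q) \<otimes> y'"
      "(z \<otimes> e [^] n) \<otimes> p = z \<otimes> e [^] n" "(z \<otimes> e [^] n) \<otimes> q = z \<otimes> e [^] n"
      "x' \<preceq> e [^] n" "y' \<preceq> e [^] n"
      "x' [^] n \<otimes> (z \<otimes> e [^] n) = y' [^] n \<otimes> (z \<otimes> e [^] n)"
      by (rule extract_large_common_part[OF xyz(1-3) assms(3) xyz(4)])
    then have "ok (x', y', z \<otimes> e [^] n)" "next_to t (x', y', z \<otimes> e [^] n)"
      unfolding ok_def next_to_def t using xyz by auto
    then show ?thesis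
      by blast
  qed
  then have next_ok: "\<And>t. ok t \<Longrightarrow> \<exists>t'. ok t' \<and> next_to t t'"
    by blast
  have start: "ok (a, b, \<one>)"
    unfolding ok_def using assms by auto
  obtain t where t: "t 0 = (a, b, \<one>)" "\<And>n. ok (t n)" "\<And>n. next_to (t n) (t (Suc n))"
    using dependent_choice_from[of ok _ next_to, OF start next_ok] by blast
  define x y z where "x i = fst (t i)" "y i = fst (snd (t i))" "z i = snd (snd (t i))" for i
  have xyz: "x i \<in> carrier G" "y i \<in> carrier G" "z i \<in> carrier G" "x 0 = a" "y 0 = b" "z 0 = \<one>"
    "\<exists>e p q. e \<in> carrier G \<and> p \<in> carrier G \<and> q \<in> carrier G \<and> z (Suc i) = z i \<otimes> e [^] n \<and>
      x i = (e \<otimes> p) \<otimes> x (Suc i) \<and> y i = (e \<otimes> q) \<otimes> y (Suc i) \<and>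
      z (Suc i) \<otimes> p = z (Suc i) \<and> z (Suc i) \<otimes> q = z (Suc i) \<and>
      x (Suc i) \<preceq> e [^] n \<and> y (Suc i) \<preceq> e [^] n" for i
    using t(1) t(2)[of i] t(3)[of i] unfolding ok_def next_to_def x_y_z_def
    by (auto simp: case_prod_unfold)
  from xyz(7) obtain e p q where e: "\<And>i. e i \<in> carrier G" and p: "\<And>i. p i \<in> carrier G"
    and q: "\<And>i. q i \<in> carrier G" and z: "\<And>i. z (Suc i) = z i \<otimes> e i [^] n"
    and x: "\<And>i. x i = (e i \<otimes> p i) \<otimes> x (Suc i)" and y: "\<And>i. y i = (e i \<otimes> q i) \<otimes> y (Suc i)"
    and zp: "\<And>i. z (Suc i) \<otimes> p i = z (Suc i)" and zq: "\<And>i. z (Suc i) \<otimes> q i = z (Suc i)"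
    and xe: "\<And>i. x (Suc i) \<preceq> e i [^] n" and ye: "\<And>i. y (Suc i) \<preceq> e i [^] n"
    by metis
  define E where "E = Sig e"
  have E: "E \<in> carrier G"
    unfolding E_def using e by auto
  define tail where "tail i = (Sig (\<lambda>j. e (i + j))) [^] n" for i
  have tail: "tail i \<in> carrier G" "tail i = e i [^] n \<otimes> tail (Suc i)" for i
  proof -
    have "Sig (\<lambda>j. e (i + j)) = e i \<otimes> Sig (\<lambda>j. e (Suc i + j))"
      using e by (subst Sig_Suc) auto
    then show "tail i = e i [^] n \<otimes> tail (Suc i)"
      unfolding tail_def using e nat_pow_distrib Sig_closed by presburger
    show "tail i \<in> carrier G"
      unfolding tail_def using e by auto
  qed
  have "E [^] n = z i \<otimes> tail i" for i
  proof (induction i)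
    case 0
    then show ?case
      using xyz(6) e unfolding E_def tail_def by simp
  next
    case (Suc i)
    then show ?case
      using z[of i] tail(2)[of i] tail(1)[of "Suc i"] e xyz(3) by (simp add: m_assoc)
  qed
  then have zE: "z i \<preceq> E [^] n" for i
    using le_mult_right[OF xyz(3)[of i] tail(1)[of i]] by simp
  obtain r where r: "r \<in> carrier G" "tail 0 = r \<otimes> Sig (\<lambda>i. e i [^] n)"
    by (rule remainder_first[of tail "\<lambda>i. e i [^] n"]) (use tail(1) e tail(2) in \<open>fast+\<close>)
  then have enE: "Sig (\<lambda>i. e i [^] n) \<preceq> E [^] n"
    unfolding tail_def E_def using e by (auto intro: le_mult_left)
  \<comment> \<open>the argument common to \<open>a\<close> and \<open>b\<close>: \<open>w\<close> is the sequence of remainders, \<open>s\<close> the dropped summands\<close>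
  have main: "w 0 = E" if w: "\<And>i. w i \<in> carrier G" "\<And>i. w i = (e i \<otimes> s i) \<otimes> w (Suc i)"
    "\<And>i. w (Suc i) \<preceq> e i [^] n" and s: "\<And>i. s i \<in> carrier G" "\<And>i. z (Suc i) \<otimes> s i = z (Suc i)"
  for w s
  proof -
    obtain l where l: "l \<in> carrier G" "\<And>i. w i = l \<otimes> Sig (\<lambda>j. e (i + j) \<otimes> s (i + j))"
      using remainder[of w "\<lambda>i. e i \<otimes> s i"] w(1,2) e s(1) by blast
    have "l \<preceq> e i [^] n" for i
    proof -
      have "l \<preceq> w (Suc i)"
        using l e s by (subst l(2)) (auto intro!: le_mult_right)
      then show ?thesis
        using w l le_trans by blast
    qed
    then have "Sig (\<lambda>_. l) \<preceq> Sig (\<lambda>i. e i [^] n)"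
      using l(1) by (intro le_Sig_mono) auto
    from le_trans[OF _ this enE] have "Sig (\<lambda>_. l) \<preceq> E [^] n"
      using l(1) by auto
    then have "E [^] n \<otimes> l = E [^] n"
      using l(1) by (intro absorb_mono[OF _ _ const_Sig_absorb]) auto
    then have El: "E \<otimes> l = E"
      by (rule absorb_if_pow_absorbs[OF E assms(3) l(1)])
    have "E [^] n \<otimes> s i = E [^] n" for i
      by (rule absorb_mono[OF xyz(3) s(1) s(2) zE])
    then have "E \<otimes> s i = E" for i
      by (rule absorb_if_pow_absorbs[OF E assms(3) s(1)])
    then have Es: "E \<otimes> Sig s = E"
      by (rule absorb_Sig[OF E s(1)])
    have "w 0 = l \<otimes> (E \<otimes> Sig s)"
      using l(2)[of 0] e s(1) unfolding E_def by (simp add: Sig_mult)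
    then show ?thesis
      using Es El E l by (simp add: m_comm)
  qed
  have "x 0 = E"
    by (rule main[OF xyz(1) x xe p zp])
  moreover have "y 0 = E"
    by (rule main[OF xyz(2) y ye q zq])
  ultimately show ?thesis
    using xyz(4,5) by simp
qed

end


section \<open>Coproducts as functions counting points in fibres\<close>

text \<open>
  The number of points of \<open>\<Union>j. P j \<times> {j}\<close> over \<open>x\<close>, a natural number or \<open>\<infinity>\<close>. Taking it in
  \<^typ>\<open>ennreal\<close> makes countable sums total and gives access to Borel measurability.
\<close>
definition fibre_count :: "(nat \<Rightarrow> 'x set) \<Rightarrow> 'x \<Rightarrow> ennreal" where
  "fibre_count P x = (\<Sum>j. indicator (P j) x)"

definition fsum :: "(nat \<Rightarrow> 'x \<Rightarrow> ennreal) \<Rightarrow> 'x \<Rightarrow> ennreal" where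
  "fsum \<Phi> = (\<lambda>x. \<Sum>j. \<Phi> j x)"

definition fadd :: "('x \<Rightarrow> ennreal) \<Rightarrow> ('x \<Rightarrow> ennreal) \<Rightarrow> 'x \<Rightarrow> ennreal" where
  "fadd \<phi> \<psi> = (\<lambda>x. \<phi> x + \<psi> x)"

lemma suminf_ennreal_swap:
  fixes f :: "nat \<Rightarrow> nat \<Rightarrow> ennreal"
  shows "(\<Sum>i. \<Sum>j. f i j) = (\<Sum>j. \<Sum>i. f i j)"
proof -
  have "(\<Sum>i. \<Sum>j. f i j) = (\<integral>\<^sup>+i. (\<Sum>j. f i j) \<partial>count_space UNIV)"
    by (rule nn_integral_count_space_nat[symmetric])
  also have "\<dots> = (\<Sum>j. \<integral>\<^sup>+i. f i j \<partial>count_space UNIV)"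
    by (rule nn_integral_suminf) simp
  finally show ?thesis
    by (simp add: nn_integral_count_space_nat)
qed

lemma suminf_ennreal_single: "(\<Sum>n. if n = k then f n else 0 :: ennreal) = f k"
  using sums_single[of k f] by (rule sums_unique[symmetric])

lemma suminf_ennreal_Suc: "(\<Sum>n. f n :: ennreal) = f 0 + (\<Sum>n. f (Suc n))"
  using sums_Suc[of f "\<Sum>n. f (Suc n)"] by (simp add: sums_iff add.commute)

lemma fsum_swap: "fsum (\<lambda>i. fsum (\<Phi> i)) = fsum (\<lambda>j. fsum (\<lambda>i. \<Phi> i j))"
  unfolding fsum_def by (subst suminf_ennreal_swap) simp

lemma fsum_prod_decode:
  "fsum (\<lambda>n. case prod_decode n of (i, j) \<Rightarrow> \<Phi> i j) = fsum (\<lambda>i. fsum (\<Phi> i))"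
  unfolding fsum_def
  using suminf_ennreal_2dimen[of "\<lambda>i. \<Sum>j. \<Phi> i j _" "\<lambda>(i, j). \<Phi> i j _"]
  by (auto simp: case_prod_unfold fun_eq_iff)

lemma fsum_fadd: "fsum (\<lambda>i. fadd (\<Phi> i) (\<Psi> i)) = fadd (fsum \<Phi>) (fsum \<Psi>)"
  unfolding fsum_def fadd_def by (simp add: suminf_add)

lemma fsum_Suc: "fsum \<Phi> = fadd (\<Phi> 0) (fsum (\<lambda>i. \<Phi> (Suc i)))"
  unfolding fsum_def fadd_def by (subst suminf_ennreal_Suc) simp

lemma fadd_zero: "fadd \<phi> (\<lambda>_. 0) = \<phi>" "fadd (\<lambda>_. 0) \<phi> = \<phi>"
  unfolding fadd_def by simp_all

text \<open>
  Padding with zeros makes binary sums an instance of countable ones (\<open>fsum_pair_seq\<close> below).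
\<close>
definition pair_seq :: "('x \<Rightarrow> ennreal) \<Rightarrow> ('x \<Rightarrow> ennreal) \<Rightarrow> nat \<Rightarrow> 'x \<Rightarrow> ennreal" where
  "pair_seq \<phi> \<psi> n = (if n = 0 then \<phi> else if n = 1 then \<psi> else (\<lambda>_. 0))"

lemma fsum_pair_seq_tail: "fsum (\<lambda>n. pair_seq \<phi> \<psi> (Suc n)) = \<psi>"
proof -
  have "(\<Sum>n. pair_seq \<phi> \<psi> (Suc n) x) = (\<Sum>n. if n = 0 then \<psi> x else 0)" for x
    by (intro arg_cong[of _ _ suminf]) (auto simp: pair_seq_def)
  then show ?thesis
    unfolding fsum_def by (simp add: suminf_ennreal_single)
qed

lemma fsum_pair_seq: "fsum (pair_seq \<phi> \<psi>) = fadd \<phi> \<psi>"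
  by (subst fsum_Suc, subst fsum_pair_seq_tail) (simp add: pair_seq_def)

lemma fibre_count_Coprod: "fibre_count (Coprod P) = fsum (\<lambda>i. fibre_count (P i))"
proof -
  have "fibre_count (Coprod P) = fsum (\<lambda>n. case prod_decode n of (i, j) \<Rightarrow> indicator (P i j))"
    unfolding fibre_count_def Coprod_def fsum_def by (auto simp: case_prod_unfold)
  also have "\<dots> = fsum (\<lambda>i. fsum (\<lambda>j. indicator (P i j)))"
    by (rule fsum_prod_decode)
  finally show ?thesis
    unfolding fibre_count_def fsum_def .
qed

lemma fibre_count_single: "fibre_count (single A) = indicator A"
proof
  fix x
  have "fibre_count (single A) x = (\<Sum>j. if j = 0 then indicator A x else 0)"
    unfolding fibre_count_def single_def by (intro arg_cong[of _ _ suminf]) auto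
  then show "fibre_count (single A) x = indicator A x"
    by (simp add: suminf_ennreal_single)
qed

text \<open>
  Every \<open>n\<close> codes exactly one index of \<open>P\<close> or of \<open>Q\<close>; as double sums over \<open>n\<close> and the coded index, the
  two contributions can be summed in the other order.
\<close>
lemma fibre_count_coprod2: "fibre_count (coprod2 P Q) = fadd (fibre_count P) (fibre_count Q)"
proof
  fix x
  let ?l = "\<lambda>n i. if n = sum_encode (Inl i) then indicator (P i) x else 0 :: ennreal"
  let ?r = "\<lambda>n i. if n = sum_encode (Inr i) then indicator (Q i) x else 0 :: ennreal"
  have "indicator (coprod2 P Q n) x = (\<Sum>i. ?l n i) + (\<Sum>i. ?r n i)" for n
  proof (cases "sum_decode n")
    case (Inl k)
    then have n: "n = sum_encode (Inl k)"
      by (metis sum_decode_inverse)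
    have "(\<Sum>i. ?l n i) = (\<Sum>i. if i = k then indicator (P i) x else 0)"
      by (intro arg_cong[of _ _ suminf]) (auto simp: n sum_encode_eq)
    moreover have "(\<Sum>i. ?r n i) = 0"
      by (simp add: n sum_encode_eq)
    ultimately show ?thesis
      by (simp add: suminf_ennreal_single coprod2_def Inl)
  next
    case (Inr k)
    then have n: "n = sum_encode (Inr k)"
      by (metis sum_decode_inverse)
    have "(\<Sum>i. ?r n i) = (\<Sum>i. if i = k then indicator (Q i) x else 0)"
      by (intro arg_cong[of _ _ suminf]) (auto simp: n sum_encode_eq)
    moreover have "(\<Sum>i. ?l n i) = 0"
      by (simp add: n sum_encode_eq)
    ultimately show ?thesis
      by (simp add: suminf_ennreal_single coprod2_def Inr)
  qed
  then have "fibre_count (coprod2 P Q) x = (\<Sum>n. (\<Sum>i. ?l n i) + (\<Sum>i. ?r n i))"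
    unfolding fibre_count_def by simp
  also have "\<dots> = (\<Sum>n. \<Sum>i. ?l n i) + (\<Sum>n. \<Sum>i. ?r n i)"
    by (simp add: suminf_add)
  also have "(\<Sum>n. \<Sum>i. ?l n i) = (\<Sum>i. \<Sum>n. ?l n i)"
    by (rule suminf_ennreal_swap)
  also have "(\<Sum>n. \<Sum>i. ?r n i) = (\<Sum>i. \<Sum>n. ?r n i)"
    by (rule suminf_ennreal_swap)
  finally show "fibre_count (coprod2 P Q) x = fadd (fibre_count P) (fibre_count Q) x"
    by (simp add: suminf_ennreal_single fadd_def fibre_count_def)
qed

text \<open>
  The position of \<open>j\<close> among the indices of the sets that contain \<open>x\<close>, counted from \<open>0\<close>.
\<close>
definition fibre_rank :: "(nat \<Rightarrow> 'x set) \<Rightarrow> nat \<Rightarrow> 'x \<Rightarrow> nat" where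
  "fibre_rank P j x = (\<Sum>i<j. indicator (P i) x)"

lemma fibre_rank_Suc: "fibre_rank P (Suc j) x = fibre_rank P j x + indicator (P j) x"
  unfolding fibre_rank_def by simp

lemma fibre_rank_mono: "i \<le> j \<Longrightarrow> fibre_rank P i x \<le> fibre_rank P j x"
  unfolding fibre_rank_def by (intro sum_mono2) auto

lemma fibre_rank_unique:
  assumes "x \<in> P i" "x \<in> P j" "fibre_rank P i x = fibre_rank P j x"
  shows "i = j"
proof -
  have "\<not> k < l" if "x \<in> P k" "fibre_rank P k x = fibre_rank P l x" for k l
    using fibre_rank_mono[of "Suc k" l P x] that by (auto simp: fibre_rank_Suc)
  then show ?thesis
    using assms by (metis linorder_neqE_nat)
qed

lemma fibre_count_eq_SUP: "fibre_count P x = (SUP m. of_nat (fibre_rank P m x))"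
proof -
  have "(\<Sum>i<m. indicator (P i) x :: ennreal) = of_nat (fibre_rank P m x)" for m
    by (induction m) (auto simp: fibre_rank_def indicator_def)
  then show ?thesis
    unfolding fibre_count_def by (simp add: suminf_eq_SUP)
qed

text \<open>
  The ranks grow in steps of at most one, so below their supremum they skip no number; the step from
  \<open>n\<close> to \<open>n + 1\<close> happens at an index of a set containing \<open>x\<close>.
\<close>
lemma less_fibre_count_iff:
  "of_nat n < fibre_count P x \<longleftrightarrow> (\<exists>k. x \<in> P k \<and> fibre_rank P k x = n)"
proof
  assume "of_nat n < fibre_count P x"
  then obtain m where "n < fibre_rank P m x"
    unfolding fibre_count_eq_SUP by (auto simp: less_SUP_iff)
  then show "\<exists>k. x \<in> P k \<and> fibre_rank P k x = n"
  proof (induction m)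
    case 0
    then show ?case
      by (simp add: fibre_rank_def)
  next
    case (Suc m)
    then show ?case
    proof (cases "n < fibre_rank P m x")
      case False
      then have "x \<in> P m" "fibre_rank P m x = n"
        using Suc.prems by (cases "x \<in> P m"; simp add: fibre_rank_Suc)+
      then show ?thesis
        by blast
    qed (use Suc.IH in blast)
  qed
next
  assume "\<exists>k. x \<in> P k \<and> fibre_rank P k x = n"
  then obtain k where "x \<in> P k" "fibre_rank P k x = n"
    by blast
  then have "n < fibre_rank P (Suc k) x"
    by (simp add: fibre_rank_Suc)
  then show "of_nat n < fibre_count P x"
    unfolding fibre_count_eq_SUP by (auto simp: less_SUP_iff)
qed

lemma borel_measurable_fibre_rank:
  assumes "\<And>j. P j \<in> sets M"
  shows "(\<lambda>x. real (fibre_rank P j x)) \<in> borel_measurable M"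
proof (induction j)
  case (Suc j)
  have "(\<lambda>x. real (fibre_rank P j x) + indicator (P j) x) \<in> borel_measurable M"
    using Suc assms by (intro borel_measurable_add borel_measurable_indicator)
  moreover have "real (indicator (P j) x) = indicator (P j) x" for x
    by (simp split: split_indicator)
  ultimately show ?case
    by (simp add: fibre_rank_Suc)
qed (simp add: fibre_rank_def)

text \<open>
  From left to right, count the pieces \<open>R j k\<close> over \<open>x\<close> in two orders. From right to left, match the
  points of the two fibres over \<open>x\<close> in the order of their indices: \<open>R j k\<close> consists of the points for
  which \<open>j\<close> and \<open>k\<close> have the same rank.
\<close>
lemma same_coprod_iff:
  "(P, Q) \<in> same_coprod \<X> \<longleftrightarrow>
    P \<in> coprods \<X> \<and> Q \<in> coprods \<X> \<and> fibre_count P = fibre_count Q"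
proof safe
  assume "(P, Q) \<in> same_coprod \<X>"
  then show "P \<in> coprods \<X>" "Q \<in> coprods \<X>"
    by (simp_all add: same_coprod_def)
  from \<open>(P, Q) \<in> same_coprod \<X>\<close> obtain R
    where "\<forall>j. disjoint_family (\<lambda>k. R j k) \<and> P j = (\<Union>k. R j k)"
      "\<forall>k. disjoint_family (\<lambda>j. R j k) \<and> Q k = (\<Union>j. R j k)"
    by (auto simp only: same_coprod_def mem_Collect_eq case_prod_conv)
  then have R: "disjoint_family (\<lambda>k. R j k)" "P j = (\<Union>k. R j k)"
    "disjoint_family (\<lambda>j. R j k)" "Q k = (\<Union>j. R j k)" for j k
    by blast+
  show "fibre_count P = fibre_count Q"
  proof
    fix x
    have "fibre_count P x = (\<Sum>j. \<Sum>k. indicator (R j k) x)"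
      unfolding fibre_count_def by (simp add: suminf_indicator R(1) R(2))
    also have "\<dots> = (\<Sum>k. \<Sum>j. indicator (R j k) x)"
      by (rule suminf_ennreal_swap)
    also have "\<dots> = fibre_count Q x"
      unfolding fibre_count_def by (simp add: suminf_indicator R(3) R(4))
    finally show "fibre_count P x = fibre_count Q x" .
  qed
next
  assume P: "P \<in> coprods \<X>" and Q: "Q \<in> coprods \<X>" and eq: "fibre_count P = fibre_count Q"
  define R where "R j k = {x \<in> P j \<inter> Q k. fibre_rank P j x = fibre_rank Q k x}" for j k
  have [measurable]: "P j \<in> sets (meas \<X>)" "Q j \<in> sets (meas \<X>)" for j
    using P Q unfolding coprods_def by auto
  have [measurable]: "(\<lambda>x. real (fibre_rank P j x)) \<in> borel_measurable (meas \<X>)"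
      "(\<lambda>x. real (fibre_rank Q j x)) \<in> borel_measurable (meas \<X>)" for j
    by (auto intro: borel_measurable_fibre_rank)
  have "R j k \<in> sets (meas \<X>)" for j k
  proof -
    have "R j k = P j \<inter> Q k \<inter>
        {x \<in> space (meas \<X>). real (fibre_rank P j x) = real (fibre_rank Q k x)}"
      unfolding R_def using sets.sets_into_space[of "P j" "meas \<X>"] by auto
    also have "\<dots> \<in> sets (meas \<X>)"
      by measurable
    finally show ?thesis .
  qed
  moreover have "disjoint_family (\<lambda>k. R j k)" for j
    unfolding R_def disjoint_family_on_def by (auto dest: fibre_rank_unique[of _ Q])
  moreover have "disjoint_family (\<lambda>j. R j k)" for k
    unfolding R_def disjoint_family_on_def by (auto dest: fibre_rank_unique[of _ P])
  moreover have "P j = (\<Union>k. R j k)" for j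
  proof -
    have "\<exists>k. x \<in> R j k" if "x \<in> P j" for x
      using that less_fibre_count_iff[of "fibre_rank P j x" P x] less_fibre_count_iff[of "fibre_rank P j x" Q x]
      unfolding eq R_def by auto
    then show ?thesis
      unfolding R_def by auto
  qed
  moreover have "Q k = (\<Union>j. R j k)" for k
  proof -
    have "\<exists>j. x \<in> R j k" if "x \<in> Q k" for x
      using that less_fibre_count_iff[of "fibre_rank Q k x" P x] less_fibre_count_iff[of "fibre_rank Q k x" Q x]
      unfolding eq R_def by auto
    then show ?thesis
      unfolding R_def by auto
  qed
  ultimately show "(P, Q) \<in> same_coprod \<X>"
    unfolding same_coprod_def mem_Collect_eq case_prod_conv
    using P Q by (intro conjI exI[of _ R] allI)
qed

lemma Coprod_coprods: "(\<And>i. P i \<in> coprods \<X>) \<Longrightarrow> Coprod P \<in> coprods \<X>"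
  by (auto simp: coprods_def Coprod_def split: prod.split)

lemma coprod2_coprods: "P \<in> coprods \<X> \<Longrightarrow> Q \<in> coprods \<X> \<Longrightarrow> coprod2 P Q \<in> coprods \<X>"
  by (auto simp: coprods_def coprod2_def split: sum.split)

lemma single_coprods: "A \<in> sets (meas \<X>) \<Longrightarrow> single A \<in> coprods \<X>"
  by (auto simp: coprods_def single_def)

lemma equiv_same_coprod: "equiv (coprods \<X>) (same_coprod \<X>)"
  by (intro equivI refl_onI symI transI) (auto simp: same_coprod_iff)

definition count_funs :: "('x, 's) stat_space \<Rightarrow> ('x \<Rightarrow> ennreal) set" where
  "count_funs \<X> = fibre_count ` coprods \<X>"

lemma fibre_count_count_funs: "P \<in> coprods \<X> \<Longrightarrow> fibre_count P \<in> count_funs \<X>"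
  unfolding count_funs_def by blast

text \<open>
  A measurable function with values in the natural numbers and \<open>\<infinity>\<close> counts the points of the coproduct
  of its superlevel sets.
\<close>
lemma count_funs_iff:
  "\<phi> \<in> count_funs \<X> \<longleftrightarrow> \<phi> \<in> borel_measurable (meas \<X>) \<and>
    (\<forall>x. \<phi> x \<in> insert \<infinity> (range of_nat)) \<and> (\<forall>x. x \<notin> space (meas \<X>) \<longrightarrow> \<phi> x = 0)"
proof safe
  assume "\<phi> \<in> count_funs \<X>"
  then obtain P where P: "\<phi> = fibre_count P" "\<And>j. P j \<in> sets (meas \<X>)"
    unfolding count_funs_def coprods_def by auto
  have [measurable]: "P j \<in> sets (meas \<X>)" for j
    by (rule P(2))
  show "\<phi> \<in> borel_measurable (meas \<X>)"
    unfolding P(1) fibre_count_def[abs_def] by measurable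
  show "\<phi> x = 0" if "x \<notin> space (meas \<X>)" for x
  proof -
    have "x \<notin> P j" for j
      using P(2)[of j] that sets.sets_into_space by blast
    then show ?thesis
      unfolding P(1) fibre_count_def by simp
  qed
  show "\<phi> x = \<infinity>" if "\<phi> x \<notin> range of_nat" for x
  proof (rule ccontr)
    assume "\<phi> x \<noteq> \<infinity>"
    then obtain m where "\<phi> x < of_nat m"
      using ennreal_Ex_less_of_nat[of "\<phi> x"] by (auto simp: less_top)
    then have ex: "\<exists>m. \<phi> x \<le> of_nat m"
      by (auto intro: less_imp_le)
    \<comment> \<open>the count is at least \<open>n\<close>, because for positive \<open>n\<close> there is a point of rank \<open>n - 1\<close>\<close>
    define n where "n = (LEAST n. \<phi> x \<le> of_nat n)"
    have le: "\<phi> x \<le> of_nat n"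
      unfolding n_def using ex by (rule LeastI_ex)
    have "of_nat n \<le> \<phi> x"
    proof (cases n)
      case (Suc l)
      then have "of_nat l < \<phi> x"
        using not_less_Least[of l "\<lambda>n. \<phi> x \<le> of_nat n"] unfolding n_def by auto
      then obtain k where "x \<in> P k" "fibre_rank P k x = l"
        using less_fibre_count_iff[of l P x] unfolding P(1) by blast
      then have "fibre_rank P (Suc k) x = n"
        using Suc by (simp add: fibre_rank_Suc)
      then show ?thesis
        unfolding P(1) fibre_count_eq_SUP by (metis SUP_upper UNIV_I)
    qed simp
    with le that show False
      by (metis antisym rangeI)
  qed
next
  assume [measurable]: "\<phi> \<in> borel_measurable (meas \<X>)"
    and nat_or_inf: "\<forall>x. \<phi> x \<in> insert \<infinity> (range of_nat)"
    and outside: "\<forall>x. x \<notin> space (meas \<X>) \<longrightarrow> \<phi> x = 0"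
  define P where "P j = {x \<in> space (meas \<X>). of_nat j < \<phi> x}" for j
  have "P \<in> coprods \<X>"
    unfolding coprods_def P_def by simp
  moreover have "fibre_count P = \<phi>"
  proof
    fix x
    have P: "x \<in> P j \<longleftrightarrow> of_nat j < \<phi> x" for j
      unfolding P_def using outside by (cases "x \<in> space (meas \<X>)") auto
    have rank: "fibre_rank P m x = card {i. i < m \<and> of_nat i < \<phi> x}" for m
    proof -
      have "fibre_rank P m x = card ({..<m} \<inter> {i. x \<in> P i})"
        unfolding fibre_rank_def by (simp add: indicator_def sum.If_cases)
      also have "{..<m} \<inter> {i. x \<in> P i} = {i. i < m \<and> of_nat i < \<phi> x}"
        using P by auto
      finally show ?thesis .
    qed
    show "fibre_count P x = \<phi> x"
    proof (cases "\<phi> x = \<infinity>")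
      case True
      then have "fibre_rank P m x = m" for m
        by (simp add: rank of_nat_less_top)
      with True show ?thesis
        by (simp only: fibre_count_eq_SUP ennreal_SUP_of_nat_eq_top infinity_ennreal_def)
    next
      case False
      then obtain n where n: "\<phi> x = of_nat n"
        using nat_or_inf by auto
      have "{i. i < m \<and> (of_nat i :: ennreal) < of_nat n} = {..<min m n}" for m
        by auto
      then have "fibre_count P x = (SUP m. of_nat (min m n))"
        unfolding fibre_count_eq_SUP rank n by simp
      also have "\<dots> = of_nat n"
        by (intro antisym SUP_least SUP_upper2[of n]) auto
      finally show ?thesis
        using n by simp
    qed
  qed
  ultimately show "\<phi> \<in> count_funs \<X>"
    unfolding count_funs_def by blast
qed


section \<open>Refinement and remainder for count functions\<close>

lemma count_funs_zero: "(\<lambda>_. 0) \<in> count_funs \<X>"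
  unfolding count_funs_iff by (auto intro: range_eqI[of _ _ 0])

lemma count_funs_fsum:
  assumes "\<And>i. \<Phi> i \<in> count_funs \<X>"
  shows "fsum \<Phi> \<in> count_funs \<X>"
proof -
  obtain P where P: "\<And>i. P i \<in> coprods \<X>" "\<And>i. \<Phi> i = fibre_count (P i)"
    using assms unfolding count_funs_def image_iff by metis
  have "fsum \<Phi> = fibre_count (Coprod P)"
    by (simp add: fibre_count_Coprod P(2)[symmetric])
  moreover have "Coprod P \<in> coprods \<X>"
    using P(1) by (rule Coprod_coprods)
  ultimately show ?thesis
    unfolding count_funs_def by blast
qed

lemma count_funs_pair_seq:
  "\<phi> \<in> count_funs \<X> \<Longrightarrow> \<psi> \<in> count_funs \<X> \<Longrightarrow> pair_seq \<phi> \<psi> n \<in> count_funs \<X>"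
  by (simp add: pair_seq_def count_funs_zero)

lemma count_funs_fadd:
  "\<phi> \<in> count_funs \<X> \<Longrightarrow> \<psi> \<in> count_funs \<X> \<Longrightarrow> fadd \<phi> \<psi> \<in> count_funs \<X>"
  unfolding fsum_pair_seq[symmetric] by (intro count_funs_fsum count_funs_pair_seq)

text \<open>
  Both sums count the points of one coproduct, presented in two ways. The pieces \<open>R m n\<close> witnessing
  that the presentations agree carry pairs \<open>m = (i, k)\<close> and \<open>n = (j, l)\<close> of indices; \<open>\<rho> i j\<close> collects the
  pieces belonging to \<open>\<Phi> i\<close> and \<open>\<Psi> j\<close>.
\<close>
lemma fsum_refinement:
  assumes \<Phi>: "\<And>i. \<Phi> i \<in> count_funs \<X>" and \<Psi>: "\<And>j. \<Psi> j \<in> count_funs \<X>"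
    and eq: "fsum \<Phi> = fsum \<Psi>"
  obtains \<rho> where "\<forall>i j. \<rho> i j \<in> count_funs \<X>" "\<forall>i. \<Phi> i = fsum (\<lambda>j. \<rho> i j)"
    "\<forall>j. \<Psi> j = fsum (\<lambda>i. \<rho> i j)"
proof -
  obtain P where P: "\<And>i. P i \<in> coprods \<X>" "\<And>i. \<Phi> i = fibre_count (P i)"
    using \<Phi> unfolding count_funs_def image_iff by metis
  obtain Q where Q: "\<And>i. Q i \<in> coprods \<X>" "\<And>i. \<Psi> i = fibre_count (Q i)"
    using \<Psi> unfolding count_funs_def image_iff by metis
  have "Coprod P \<in> coprods \<X>" "Coprod Q \<in> coprods \<X>"
    using P(1) Q(1) by (auto intro: Coprod_coprods)
  moreover have "fibre_count (Coprod P) = fibre_count (Coprod Q)"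
    using eq by (simp add: fibre_count_Coprod P(2)[symmetric] Q(2)[symmetric])
  ultimately have "(Coprod P, Coprod Q) \<in> same_coprod \<X>"
    unfolding same_coprod_iff by blast
  then obtain R where "\<forall>m n. R m n \<in> sets (meas \<X>)"
    "\<forall>m. disjoint_family (\<lambda>n. R m n) \<and> Coprod P m = (\<Union>n. R m n)"
    "\<forall>n. disjoint_family (\<lambda>m. R m n) \<and> Coprod Q n = (\<Union>m. R m n)"
    by (auto simp only: same_coprod_def mem_Collect_eq case_prod_conv)
  then have R: "R m n \<in> sets (meas \<X>)" "disjoint_family (\<lambda>n. R m n)" "Coprod P m = (\<Union>n. R m n)"
    "disjoint_family (\<lambda>m. R m n)" "Coprod Q n = (\<Union>m. R m n)" for m n
    by simp_all
  define S where "S i j k l = R (prod_encode (i, k)) (prod_encode (j, l))" for i j k l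
  define \<rho> where "\<rho> i j = fibre_count (Coprod (\<lambda>k l. S i j k l))" for i j
  have \<rho>: "\<rho> i j = fsum (\<lambda>k. fsum (\<lambda>l. indicator (S i j k l)))" for i j
    unfolding \<rho>_def by (simp add: fibre_count_Coprod) (simp add: fsum_def fibre_count_def)
  show thesis
  proof (rule that[rule_format])
    fix i j
    have "Coprod (\<lambda>k l. S i j k l) \<in> coprods \<X>"
      using R(1) by (intro Coprod_coprods) (simp add: coprods_def S_def)
    then show "\<rho> i j \<in> count_funs \<X>"
      unfolding \<rho>_def count_funs_def by blast
  next
    fix i
    have row: "fsum (\<lambda>j. fsum (\<lambda>l. indicator (S i j k l))) = indicator (P i k)" for k
    proof -
      have "P i k = Coprod P (prod_encode (i, k))"
        by (simp add: Coprod_def)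
      then have "indicator (P i k) x = (\<Sum>n. indicator (R (prod_encode (i, k)) n) x :: ennreal)" for x
        using suminf_indicator[OF R(2)] R(3) by simp
      moreover have "fsum (\<lambda>n. indicator (R (prod_encode (i, k)) n)) =
          fsum (\<lambda>n. case prod_decode n of (j, l) \<Rightarrow> indicator (S i j k l))"
        by (rule arg_cong[of _ _ fsum]) (auto simp: S_def split: prod.split
              dest!: arg_cong[of _ _ prod_encode])
      ultimately show ?thesis
        unfolding fsum_prod_decode[symmetric] by (auto simp: fsum_def fun_eq_iff)
    qed
    have "fsum (\<lambda>j. \<rho> i j) = fsum (\<lambda>k. fsum (\<lambda>j. fsum (\<lambda>l. indicator (S i j k l))))"
      unfolding \<rho> by (rule fsum_swap)
    also have "\<dots> = \<Phi> i"
      unfolding row P(2) by (simp add: fsum_def fibre_count_def fun_eq_iff)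
    finally show "\<Phi> i = fsum (\<lambda>j. \<rho> i j)" ..
  next
    fix j
    have col: "fsum (\<lambda>i. fsum (\<lambda>k. indicator (S i j k l))) = indicator (Q j l)" for l
    proof -
      have "Q j l = Coprod Q (prod_encode (j, l))"
        by (simp add: Coprod_def)
      then have "indicator (Q j l) x = (\<Sum>n. indicator (R n (prod_encode (j, l))) x :: ennreal)" for x
        using suminf_indicator[OF R(4)] R(5) by simp
      moreover have "fsum (\<lambda>n. indicator (R n (prod_encode (j, l)))) =
          fsum (\<lambda>n. case prod_decode n of (i, k) \<Rightarrow> indicator (S i j k l))"
        by (rule arg_cong[of _ _ fsum]) (auto simp: S_def split: prod.split
              dest!: arg_cong[of _ _ prod_encode])
      ultimately show ?thesis
        unfolding fsum_prod_decode[symmetric] by (auto simp: fsum_def fun_eq_iff)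
    qed
    have "\<rho> i j = fsum (\<lambda>l. fsum (\<lambda>k. indicator (S i j k l)))" for i
      unfolding \<rho> by (rule fsum_swap)
    then have "fsum (\<lambda>i. \<rho> i j) = fsum (\<lambda>l. fsum (\<lambda>i. fsum (\<lambda>k. indicator (S i j k l))))"
      using fsum_swap by simp
    also have "\<dots> = \<Psi> j"
      unfolding col Q(2) by (simp add: fsum_def fibre_count_def fun_eq_iff)
    finally show "\<Psi> j = fsum (\<lambda>i. \<rho> i j)" ..
  qed
qed

lemma Inf_of_nats_attained:
  fixes S :: "ennreal set"
  assumes "S \<noteq> {}" "S \<subseteq> insert \<infinity> (range of_nat)"
  shows "Inf S \<in> S"
proof (cases "\<exists>n. of_nat n \<in> S")
  case True
  define n where "n = (LEAST n. of_nat n \<in> S)"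
  have n: "of_nat n \<in> S"
    unfolding n_def using True by (rule LeastI_ex)
  have "of_nat n \<le> s" if s: "s \<in> S" for s
  proof (cases "s = \<infinity>")
    case False
    then obtain m where "s = of_nat m"
      using subsetD[OF assms(2) s] by auto
    then show ?thesis
      using s unfolding n_def by (simp add: Least_le)
  qed simp
  then have "Inf S = of_nat n"
    using n by (intro antisym Inf_greatest Inf_lower)
  then show ?thesis
    using n by simp
next
  case False
  then have "S = {\<infinity>}"
    using assms by auto
  then show ?thesis
    by simp
qed

text \<open>
  The pointwise limit of the decreasing sequence \<open>\<Phi>\<close> does it: \<open>\<Phi> n\<close> is a partial sum of the \<open>\<Gamma> (n + i)\<close>
  plus a later \<open>\<Phi>\<close>, and addition is continuous, also at \<open>\<infinity>\<close>.
\<close>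
lemma fsum_remainder:
  assumes \<Phi>: "\<And>n. \<Phi> n \<in> count_funs \<X>" and \<Gamma>: "\<And>n. \<Gamma> n \<in> count_funs \<X>"
    and step: "\<And>n. \<Phi> n = fadd (\<Gamma> n) (\<Phi> (Suc n))"
  obtains \<kappa> where "\<kappa> \<in> count_funs \<X>" "\<forall>n. \<Phi> n = fadd \<kappa> (fsum (\<lambda>i. \<Gamma> (n + i)))"
proof (rule that[rule_format])
  let ?\<kappa> = "\<lambda>x. INF n. \<Phi> n x"
  have \<Phi>': "\<Phi> n \<in> borel_measurable (meas \<X>)" "\<Phi> n x \<in> insert \<infinity> (range of_nat)"
    "x \<notin> space (meas \<X>) \<Longrightarrow> \<Phi> n x = 0" for n x
    using \<Phi>[of n] unfolding count_funs_iff by auto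
  have "?\<kappa> x \<in> range (\<lambda>n. \<Phi> n x)" for x
    by (rule Inf_of_nats_attained) (use \<Phi>'(2) in auto)
  then have "?\<kappa> x \<in> insert \<infinity> (range of_nat)" for x
    using \<Phi>'(2) by (metis (no_types, lifting) imageE)
  moreover have "?\<kappa> \<in> borel_measurable (meas \<X>)"
    using \<Phi>'(1) by measurable
  ultimately show "?\<kappa> \<in> count_funs \<X>"
    unfolding count_funs_iff using \<Phi>'(3) by simp
  fix n
  show "\<Phi> n = fadd ?\<kappa> (fsum (\<lambda>i. \<Gamma> (n + i)))"
  proof
    fix x
    have partial: "\<Phi> n x = (\<Sum>i<m. \<Gamma> (n + i) x) + \<Phi> (m + n) x" for m
    proof (induction m)
      case (Suc m)
      then show ?case
        using step[of "m + n"] by (simp add: fadd_def ac_simps)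
    qed simp
    have "decseq (\<lambda>m. \<Phi> m x)"
      unfolding decseq_Suc_iff using step by (metis (no_types, lifting) add_increasing fadd_def order_refl zero_le)
    then have "(\<lambda>m. \<Phi> (m + n) x) \<longlonglongrightarrow> ?\<kappa> x"
      by (intro LIMSEQ_ignore_initial_segment LIMSEQ_INF)
    moreover have "(\<lambda>m. \<Sum>i<m. \<Gamma> (n + i) x) \<longlonglongrightarrow> (\<Sum>i. \<Gamma> (n + i) x)"
      by (rule summable_LIMSEQ) simp
    ultimately have "(\<lambda>m. (\<Sum>i<m. \<Gamma> (n + i) x) + \<Phi> (m + n) x) \<longlonglongrightarrow> (\<Sum>i. \<Gamma> (n + i) x) + ?\<kappa> x"
      by (intro tendsto_add)
    then have "(\<lambda>m. \<Phi> n x) \<longlonglongrightarrow> (\<Sum>i. \<Gamma> (n + i) x) + ?\<kappa> x"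
      by (simp add: partial[symmetric])
    then show "\<Phi> n x = fadd ?\<kappa> (fsum (\<lambda>i. \<Gamma> (n + i))) x"
      by (simp add: LIMSEQ_const_iff fadd_def fsum_def add.commute)
  qed
qed


section \<open>Common multiples in an inverse monoid\<close>

context inverse_monoid
begin

lemma weak_inverse_unique:
  assumes "s \<in> carrier G" "p \<in> carrier G" "q \<in> carrier G"
    "s \<otimes> p \<otimes> s = s" "p \<otimes> s \<otimes> p = p" "s \<otimes> q \<otimes> s = s" "q \<otimes> s \<otimes> q = q"
  shows "p = q"
  using ex1_weak_inverse[OF assms(1)] assms by blast

text \<open>
  If \<open>x\<close> is the weak inverse of \<open>e f\<close>, so is \<open>f x e\<close>. Hence \<open>x = f x e\<close>, which is idempotent and
  therefore its own weak inverse; but \<open>e f\<close> is a weak inverse of \<open>x\<close>, so \<open>x = e f\<close>.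
\<close>
lemma idempotent_mult_idempotent:
  assumes e: "e \<in> carrier G" "e \<otimes> e = e" and f: "f \<in> carrier G" "f \<otimes> f = f"
  shows "(e \<otimes> f) \<otimes> (e \<otimes> f) = e \<otimes> f"
proof -
  obtain x where x: "x \<in> carrier G" "(e \<otimes> f) \<otimes> x \<otimes> (e \<otimes> f) = e \<otimes> f" "x \<otimes> (e \<otimes> f) \<otimes> x = x"
    using ex1_weak_inverse[of "e \<otimes> f"] e f by blast
  define y where "y = f \<otimes> x \<otimes> e"
  have y: "y \<in> carrier G"
    unfolding y_def using e f x by simp
  have ee: "e \<otimes> (e \<otimes> z) = e \<otimes> z" and ff: "f \<otimes> (f \<otimes> z) = f \<otimes> z" if "z \<in> carrier G" for z
    using that e f by (simp_all add: m_assoc[symmetric])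
  have x2: "e \<otimes> (f \<otimes> (x \<otimes> (e \<otimes> f))) = e \<otimes> f" "x \<otimes> (e \<otimes> (f \<otimes> x)) = x"
    using x e f by (simp_all add: m_assoc)
  then have x3: "x \<otimes> (e \<otimes> (f \<otimes> (x \<otimes> z))) = x \<otimes> z" if "z \<in> carrier G" for z
    using that x(1) e f by (metis m_assoc m_closed)
  have "x = y"
  proof (rule weak_inverse_unique[of "e \<otimes> f"])
    show "(e \<otimes> f) \<otimes> y \<otimes> (e \<otimes> f) = e \<otimes> f"
      unfolding y_def using x2 x e f by (simp add: m_assoc ee ff)
    show "y \<otimes> (e \<otimes> f) \<otimes> y = y"
      unfolding y_def using x3 x e f by (simp add: m_assoc ee ff)
  qed (use x y e f in auto)
  moreover have "y \<otimes> y = y"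
    unfolding y_def using x3 x e f by (simp add: m_assoc)
  ultimately have "x \<otimes> x = x"
    by simp
  then have "x = e \<otimes> f"
    using x e f by (intro weak_inverse_unique[of x x "e \<otimes> f"]) auto
  then show ?thesis
    using \<open>x \<otimes> x = x\<close> by simp
qed

text \<open>
  As \<open>e f\<close> and \<open>f e\<close> are idempotent, both are weak inverses of \<open>e f\<close>.
\<close>
lemma idempotents_commute:
  assumes e: "e \<in> carrier G" "e \<otimes> e = e" and f: "f \<in> carrier G" "f \<otimes> f = f"
  shows "e \<otimes> f = f \<otimes> e"
proof (rule weak_inverse_unique[of "e \<otimes> f"])
  have ee: "e \<otimes> (e \<otimes> z) = e \<otimes> z" and ff: "f \<otimes> (f \<otimes> z) = f \<otimes> z" if "z \<in> carrier G" for z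
    using that e f by (simp_all add: m_assoc[symmetric])
  show "(e \<otimes> f) \<otimes> (f \<otimes> e) \<otimes> (e \<otimes> f) = e \<otimes> f" "(f \<otimes> e) \<otimes> (e \<otimes> f) \<otimes> (f \<otimes> e) = f \<otimes> e"
    using idempotent_mult_idempotent[OF e f] idempotent_mult_idempotent[OF f e] e f
    by (simp_all add: m_assoc ee ff)
qed (use e f idempotent_mult_idempotent[OF e f] in auto)

text \<open>
  With weak inverses \<open>t'\<close> and \<open>u'\<close>, the product of the commuting idempotents \<open>t t'\<close> and \<open>u u'\<close> is a right
  multiple of both \<open>t\<close> and \<open>u\<close>.
\<close>
lemma common_right_multiple:
  assumes "t \<in> carrier G" "u \<in> carrier G"
  obtains v w where "v \<in> carrier G" "w \<in> carrier G" "t \<otimes> v = u \<otimes> w"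
proof -
  obtain t' where t': "t' \<in> carrier G" "t \<otimes> t' \<otimes> t = t"
    using ex1_weak_inverse[OF assms(1)] by blast
  obtain u' where u': "u' \<in> carrier G" "u \<otimes> u' \<otimes> u = u"
    using ex1_weak_inverse[OF assms(2)] by blast
  have "(t \<otimes> t') \<otimes> (t \<otimes> t') = t \<otimes> t'" "(u \<otimes> u') \<otimes> (u \<otimes> u') = u \<otimes> u'"
    using t' u' assms by (metis m_assoc m_closed)+
  then have "(t \<otimes> t') \<otimes> (u \<otimes> u') = (u \<otimes> u') \<otimes> (t \<otimes> t')"
    using t' u' assms by (intro idempotents_commute) auto
  then have "t \<otimes> (t' \<otimes> (u \<otimes> u')) = u \<otimes> (u' \<otimes> (t \<otimes> t'))"
    using t' u' assms by (simp add: m_assoc)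
  then show thesis
    using t' u' assms by (intro that[of "t' \<otimes> (u \<otimes> u')" "u' \<otimes> (t \<otimes> t')"]) auto
qed

end


section \<open>Equidecomposability of count functions\<close>

definition pull :: "('x, 's) stat_space \<Rightarrow> 's \<Rightarrow> ('x \<Rightarrow> ennreal) \<Rightarrow> 'x \<Rightarrow> ennreal" where
  "pull \<X> s \<phi> = (\<lambda>x. if x \<in> space (meas \<X>) then \<phi> (act \<X> s x) else 0)"

text \<open>
  Equidecomposability in one piece. The general relation sums countably many such steps.
\<close>
definition elem_equidec :: "('x, 's) stat_space \<Rightarrow> ('x \<Rightarrow> ennreal) \<Rightarrow> ('x \<Rightarrow> ennreal) \<Rightarrow> bool" where
  "elem_equidec \<X> \<phi> \<psi> \<longleftrightarrow>
    (\<exists>s\<in>carrier (monoid_of \<X>). \<exists>t\<in>carrier (monoid_of \<X>). pull \<X> s \<phi> = pull \<X> t \<psi>)"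

definition fun_equidec :: "('x, 's) stat_space \<Rightarrow> ('x \<Rightarrow> ennreal) \<Rightarrow> ('x \<Rightarrow> ennreal) \<Rightarrow> bool" where
  "fun_equidec \<X> \<phi> \<psi> \<longleftrightarrow> (\<exists>\<Phi> \<Psi>.
    (\<forall>j. \<Phi> j \<in> count_funs \<X> \<and> \<Psi> j \<in> count_funs \<X> \<and> elem_equidec \<X> (\<Phi> j) (\<Psi> j)) \<and>
    \<phi> = fsum \<Phi> \<and> \<psi> = fsum \<Psi>)"

lemma pull_fsum: "pull \<X> s (fsum \<Phi>) = fsum (\<lambda>j. pull \<X> s (\<Phi> j))"
  unfolding pull_def fsum_def by auto

lemma fibre_count_coprod_preim: "fibre_count (coprod_preim \<X> s P) = pull \<X> s (fibre_count P)"
proof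
  show "fibre_count (coprod_preim \<X> s P) x = pull \<X> s (fibre_count P) x" for x
    by (cases "x \<in> space (meas \<X>)")
       (simp_all add: fibre_count_def coprod_preim_def preim_def pull_def indicator_def)
qed

context stat_meas_space
begin

sublocale acting: inverse_monoid "monoid_of \<X>"
  by (rule inverse_monoid)

lemma act_space: "s \<in> carrier (monoid_of \<X>) \<Longrightarrow> x \<in> space (meas \<X>) \<Longrightarrow> act \<X> s x \<in> space (meas \<X>)"
  using measurable_space[OF act_measurable] .

lemma preim_sets: "s \<in> carrier (monoid_of \<X>) \<Longrightarrow> A \<in> sets (meas \<X>) \<Longrightarrow> preim \<X> s A \<in> sets (meas \<X>)"
  unfolding preim_def using measurable_sets[OF act_measurable] .

lemma coprod_preim_coprods:
  "s \<in> carrier (monoid_of \<X>) \<Longrightarrow> P \<in> coprods \<X> \<Longrightarrow> coprod_preim \<X> s P \<in> coprods \<X>"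
  by (simp add: coprods_def coprod_preim_def preim_sets)

lemma count_funs_pull:
  "s \<in> carrier (monoid_of \<X>) \<Longrightarrow> \<phi> \<in> count_funs \<X> \<Longrightarrow> pull \<X> s \<phi> \<in> count_funs \<X>"
  unfolding count_funs_def by (auto simp: fibre_count_coprod_preim[symmetric] coprod_preim_coprods)

lemma pull_mult:
  "s \<in> carrier (monoid_of \<X>) \<Longrightarrow> t \<in> carrier (monoid_of \<X>) \<Longrightarrow>
    pull \<X> (s \<otimes>\<^bsub>monoid_of \<X>\<^esub> t) \<phi> = pull \<X> t (pull \<X> s \<phi>)"
  unfolding pull_def by (auto simp: act_mult act_space)

lemma pull_one: "\<phi> \<in> count_funs \<X> \<Longrightarrow> pull \<X> \<one>\<^bsub>monoid_of \<X>\<^esub> \<phi> = \<phi>"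
  unfolding pull_def count_funs_iff by (auto simp: act_one)

lemma elem_equidec_refl: "elem_equidec \<X> \<phi> \<phi>"
  unfolding elem_equidec_def using acting.one_closed by blast

lemma elem_equidec_sym: "elem_equidec \<X> \<phi> \<psi> \<Longrightarrow> elem_equidec \<X> \<psi> \<phi>"
  unfolding elem_equidec_def by metis

lemma elem_equidec_pull:
  assumes "s \<in> carrier (monoid_of \<X>)" "\<phi> \<in> count_funs \<X>"
  shows "elem_equidec \<X> \<phi> (pull \<X> s \<phi>)"
proof -
  have "pull \<X> s \<phi> = pull \<X> \<one>\<^bsub>monoid_of \<X>\<^esub> (pull \<X> s \<phi>)"
    by (rule pull_one[OF count_funs_pull[OF assms], symmetric])
  then show ?thesis
    unfolding elem_equidec_def by (intro bexI[where x = s] bexI) (auto simp: assms(1))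
qed

text \<open>
  The two pullbacks of \<open>\<psi>\<close> involved, along \<open>t\<close> and \<open>u\<close>, become equal after pulling back further to a
  common right multiple of \<open>t\<close> and \<open>u\<close>.
\<close>
lemma elem_equidec_trans:
  assumes "elem_equidec \<X> \<phi> \<psi>" "elem_equidec \<X> \<psi> \<omega>"
  shows "elem_equidec \<X> \<phi> \<omega>"
proof -
  obtain s t where st: "s \<in> carrier (monoid_of \<X>)" "t \<in> carrier (monoid_of \<X>)"
    "pull \<X> s \<phi> = pull \<X> t \<psi>"
    using assms(1) unfolding elem_equidec_def by blast
  obtain u v where uv: "u \<in> carrier (monoid_of \<X>)" "v \<in> carrier (monoid_of \<X>)"
    "pull \<X> u \<psi> = pull \<X> v \<omega>"
    using assms(2) unfolding elem_equidec_def by blast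
  obtain p q where pq: "p \<in> carrier (monoid_of \<X>)" "q \<in> carrier (monoid_of \<X>)"
    "t \<otimes>\<^bsub>monoid_of \<X>\<^esub> p = u \<otimes>\<^bsub>monoid_of \<X>\<^esub> q"
    by (rule acting.common_right_multiple[OF st(2) uv(1)])
  have "pull \<X> (s \<otimes>\<^bsub>monoid_of \<X>\<^esub> p) \<phi> = pull \<X> (t \<otimes>\<^bsub>monoid_of \<X>\<^esub> p) \<psi>"
    using st pq(1) by (simp add: pull_mult)
  also have "\<dots> = pull \<X> (v \<otimes>\<^bsub>monoid_of \<X>\<^esub> q) \<omega>"
    unfolding pq(3) using uv pq by (simp add: pull_mult)
  finally show ?thesis
    unfolding elem_equidec_def using st uv pq by (meson acting.m_closed)
qed

text \<open>
  Let \<open>s'\<close> be a weak inverse of \<open>s\<close>. Pulling the equation between \<open>\<phi>\<close> and \<open>\<Sum>k. \<Psi> k\<close> back along \<open>s'\<close>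
  decomposes not \<open>\<phi>\<close> but its composition \<open>\<phi>'\<close> with \<open>s s'\<close>. At points of the form \<open>s x\<close> the
  functions \<open>\<phi>\<close> and \<open>\<phi>'\<close> agree, since \<open>s s' s = s\<close>. So the values of \<open>\<phi>\<close> where they differ do not show after
  pulling back along \<open>s\<close>, and it does not matter which of the pieces receives them.
\<close>
lemma elem_equidec_split:
  assumes \<phi>: "\<phi> \<in> count_funs \<X>" and \<Psi>: "\<And>k. \<Psi> k \<in> count_funs \<X>"
    and "elem_equidec \<X> \<phi> (fsum \<Psi>)"
  obtains \<Phi> where "\<forall>k. \<Phi> k \<in> count_funs \<X>" "\<phi> = fsum \<Phi>" "\<forall>k. elem_equidec \<X> (\<Phi> k) (\<Psi> k)"
proof -
  obtain s t where st: "s \<in> carrier (monoid_of \<X>)" "t \<in> carrier (monoid_of \<X>)"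
    "pull \<X> s \<phi> = pull \<X> t (fsum \<Psi>)"
    using assms(3) unfolding elem_equidec_def by blast
  obtain s' where s': "s' \<in> carrier (monoid_of \<X>)"
    "s \<otimes>\<^bsub>monoid_of \<X>\<^esub> s' \<otimes>\<^bsub>monoid_of \<X>\<^esub> s = s"
    using acting.ex1_weak_inverse[OF st(1)] by blast
  define \<phi>' where "\<phi>' = pull \<X> s' (pull \<X> s \<phi>)"
  define \<Psi>' where "\<Psi>' k = pull \<X> s' (pull \<X> t (\<Psi> k))" for k
  have \<phi>': "\<phi>' \<in> count_funs \<X>" "\<phi>' = fsum \<Psi>'"
  proof -
    show "\<phi>' \<in> count_funs \<X>"
      unfolding \<phi>'_def using st(1) s'(1) \<phi> by (intro count_funs_pull)
    show "\<phi>' = fsum \<Psi>'"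
      unfolding \<phi>'_def st(3) pull_fsum by (simp add: \<Psi>'_def[abs_def])
  qed
  have \<Psi>': "\<Psi>' k \<in> count_funs \<X>" for k
    unfolding \<Psi>'_def using st s' \<Psi> by (auto simp: count_funs_pull)
  have sss: "pull \<X> s (pull \<X> s' (pull \<X> s \<omega>)) = pull \<X> s \<omega>" for \<omega>
    using st(1) s' pull_mult[of "s \<otimes>\<^bsub>monoid_of \<X>\<^esub> s'" s \<omega>] pull_mult[of s s' \<omega>] by simp
  then have "pull \<X> s \<phi>' = pull \<X> s \<phi>"
    unfolding \<phi>'_def .
  then have agree: "\<phi> (act \<X> s x) = \<phi>' (act \<X> s x)" if "x \<in> space (meas \<X>)" for x
    using that by (auto simp: pull_def dest: fun_cong[of _ _ x])
  \<comment> \<open>piece \<open>0\<close> receives the part of \<open>\<phi>\<close> that \<open>\<phi>'\<close> does not reproduce\<close>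
  define \<Phi> where "\<Phi> k x = (if \<phi> x = \<phi>' x then \<Psi>' k x else if k = 0 then \<phi> x else 0)" for k x
  show thesis
  proof (rule that[rule_format])
    fix k
    have [measurable]: "\<phi> \<in> borel_measurable (meas \<X>)" "\<phi>' \<in> borel_measurable (meas \<X>)"
      "\<Psi>' k \<in> borel_measurable (meas \<X>)"
      using \<phi> \<phi>'(1) \<Psi>' unfolding count_funs_iff by auto
    have "\<Phi> k \<in> borel_measurable (meas \<X>)"
      unfolding \<Phi>_def[abs_def] by measurable
    moreover have "\<Phi> k x \<in> insert \<infinity> (range of_nat)" for x
      using \<phi> \<Psi>'[of k] unfolding count_funs_iff \<Phi>_def by (auto intro: range_eqI[of _ _ 0])
    moreover have "\<Phi> k x = 0" if "x \<notin> space (meas \<X>)" for x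
      using that \<phi> \<phi>'(1) \<Psi>'[of k] unfolding count_funs_iff \<Phi>_def by auto
    ultimately show "\<Phi> k \<in> count_funs \<X>"
      unfolding count_funs_iff by blast
    have "pull \<X> s (\<Phi> k) = pull \<X> s (\<Psi>' k)"
      by (auto simp: pull_def \<Phi>_def agree)
    also have "\<dots> = pull \<X> (t \<otimes>\<^bsub>monoid_of \<X>\<^esub> s' \<otimes>\<^bsub>monoid_of \<X>\<^esub> s) (\<Psi> k)"
      unfolding \<Psi>'_def using st s' by (simp add: pull_mult)
    finally show "elem_equidec \<X> (\<Phi> k) (\<Psi> k)"
      unfolding elem_equidec_def using st s' by (meson acting.m_closed)
  next
    show "\<phi> = fsum \<Phi>"
    proof
      fix x
      show "\<phi> x = fsum \<Phi> x"
      proof (cases "\<phi> x = \<phi>' x")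
        case True
        then show ?thesis
          using \<phi>'(2) by (simp add: fsum_def \<Phi>_def fun_eq_iff)
      next
        case False
        then show ?thesis
          by (simp add: fsum_def \<Phi>_def suminf_ennreal_single)
      qed
    qed
  qed
qed

lemma fun_equidecI:
  "\<lbrakk>\<And>j. \<Phi> j \<in> count_funs \<X>; \<And>j. \<Psi> j \<in> count_funs \<X>; \<And>j. elem_equidec \<X> (\<Phi> j) (\<Psi> j);
    \<phi> = fsum \<Phi>; \<psi> = fsum \<Psi>\<rbrakk> \<Longrightarrow> fun_equidec \<X> \<phi> \<psi>"
  unfolding fun_equidec_def by (rule exI[of _ \<Phi>], rule exI[of _ \<Psi>]) simp

lemma fun_equidecE:
  assumes "fun_equidec \<X> \<phi> \<psi>"
  obtains \<Phi> \<Psi> where "\<forall>j. \<Phi> j \<in> count_funs \<X>" "\<forall>j. \<Psi> j \<in> count_funs \<X>"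
    "\<forall>j. elem_equidec \<X> (\<Phi> j) (\<Psi> j)" "\<phi> = fsum \<Phi>" "\<psi> = fsum \<Psi>"
proof -
  from assms obtain \<Phi> \<Psi> where "\<forall>j. \<Phi> j \<in> count_funs \<X> \<and> \<Psi> j \<in> count_funs \<X> \<and>
      elem_equidec \<X> (\<Phi> j) (\<Psi> j)" "\<phi> = fsum \<Phi>" "\<psi> = fsum \<Psi>"
    unfolding fun_equidec_def by (elim exE conjE)
  then show thesis
    by (intro that[of \<Phi> \<Psi>]) simp_all
qed

lemma fun_equidec_elem:
  assumes "\<phi> \<in> count_funs \<X>" "\<psi> \<in> count_funs \<X>" "elem_equidec \<X> \<phi> \<psi>"
  shows "fun_equidec \<X> \<phi> \<psi>"
proof (rule fun_equidecI)
  let ?z = "\<lambda>_. 0"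
  show "elem_equidec \<X> (pair_seq \<phi> ?z j) (pair_seq \<psi> ?z j)" for j
    using assms(3) by (auto simp: pair_seq_def elem_equidec_refl)
  show "\<phi> = fsum (pair_seq \<phi> ?z)" "\<psi> = fsum (pair_seq \<psi> ?z)"
    by (simp_all add: fsum_pair_seq fadd_zero)
qed (use assms in \<open>auto intro: count_funs_pair_seq count_funs_zero\<close>)

lemma fun_equidec_refl: "\<phi> \<in> count_funs \<X> \<Longrightarrow> fun_equidec \<X> \<phi> \<phi>"
  by (intro fun_equidec_elem elem_equidec_refl)

lemma fun_equidec_sym: "fun_equidec \<X> \<phi> \<psi> \<Longrightarrow> fun_equidec \<X> \<psi> \<phi>"
  by (elim fun_equidecE, rule fun_equidecI) (auto intro: elem_equidec_sym)

lemma fun_equidec_fsum: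
  assumes "\<And>i. fun_equidec \<X> (\<Phi> i) (\<Psi> i)"
  shows "fun_equidec \<X> (fsum \<Phi>) (fsum \<Psi>)"
proof -
  have "\<forall>i. \<exists>\<Theta> \<Lambda>. (\<forall>j. \<Theta> j \<in> count_funs \<X> \<and> \<Lambda> j \<in> count_funs \<X> \<and> elem_equidec \<X> (\<Theta> j) (\<Lambda> j)) \<and>
      \<Phi> i = fsum \<Theta> \<and> \<Psi> i = fsum \<Lambda>"
    using assms unfolding fun_equidec_def by simp
  then obtain \<Theta> \<Lambda> where *: "\<And>i j. \<Theta> i j \<in> count_funs \<X>" "\<And>i j. \<Lambda> i j \<in> count_funs \<X>"
      "\<And>i j. elem_equidec \<X> (\<Theta> i j) (\<Lambda> i j)" "\<And>i. \<Phi> i = fsum (\<Theta> i)" "\<And>i. \<Psi> i = fsum (\<Lambda> i)"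
    by metis
  show ?thesis
  proof (rule fun_equidecI)
    show "fsum \<Phi> = fsum (\<lambda>n. case prod_decode n of (i, j) \<Rightarrow> \<Theta> i j)"
      "fsum \<Psi> = fsum (\<lambda>n. case prod_decode n of (i, j) \<Rightarrow> \<Lambda> i j)"
      unfolding fsum_prod_decode by (simp_all add: *(4,5)[symmetric])
  qed (use *(1-3) in \<open>auto split: prod.split\<close>)
qed

lemma fun_equidec_fadd:
  assumes "fun_equidec \<X> \<phi> \<phi>'" "fun_equidec \<X> \<psi> \<psi>'"
  shows "fun_equidec \<X> (fadd \<phi> \<psi>) (fadd \<phi>' \<psi>')"
  unfolding fsum_pair_seq[symmetric]
  by (rule fun_equidec_fsum) (use assms in \<open>simp add: pair_seq_def fun_equidec_refl count_funs_zero\<close>)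

text \<open>
  Refine the decomposition of \<open>fsum \<Psi>\<close> into single steps against its decomposition into the \<open>\<Psi> k\<close>, split
  each step accordingly, and collect the pieces belonging to the same \<open>k\<close>.
\<close>
lemma fun_equidec_split:
  assumes "fun_equidec \<X> \<phi> (fsum \<Psi>)" "\<And>k. \<Psi> k \<in> count_funs \<X>"
  obtains \<Phi> where "\<forall>k. \<Phi> k \<in> count_funs \<X>" "\<phi> = fsum \<Phi>" "\<forall>k. fun_equidec \<X> (\<Phi> k) (\<Psi> k)"
proof -
  obtain \<Theta> \<Lambda> where 1: "\<forall>j. \<Theta> j \<in> count_funs \<X>" "\<forall>j. \<Lambda> j \<in> count_funs \<X>"
    "\<forall>j. elem_equidec \<X> (\<Theta> j) (\<Lambda> j)" "\<phi> = fsum \<Theta>" "fsum \<Psi> = fsum \<Lambda>"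
    by (rule fun_equidecE[OF assms(1)])
  obtain \<rho> where "\<forall>j k. \<rho> j k \<in> count_funs \<X>" "\<forall>j. \<Lambda> j = fsum (\<lambda>k. \<rho> j k)"
    "\<forall>k. \<Psi> k = fsum (\<lambda>j. \<rho> j k)"
    by (rule fsum_refinement[OF 1(2)[rule_format] assms(2) 1(5)[symmetric]])
  note \<rho> = this[rule_format]
  have "\<exists>\<sigma>. (\<forall>k. \<sigma> k \<in> count_funs \<X>) \<and> (\<forall>k. elem_equidec \<X> (\<sigma> k) (\<rho> j k)) \<and> \<Theta> j = fsum \<sigma>" for j
  proof -
    obtain \<sigma> where "\<forall>k. \<sigma> k \<in> count_funs \<X>" "\<Theta> j = fsum \<sigma>" "\<forall>k. elem_equidec \<X> (\<sigma> k) (\<rho> j k)"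
      by (rule elem_equidec_split[of "\<Theta> j" "\<rho> j"]) (use 1(1,3) \<rho>(1) \<rho>(2)[symmetric] in simp_all)
    then show ?thesis
      by blast
  qed
  then obtain \<sigma> where \<sigma>: "\<And>j k. \<sigma> j k \<in> count_funs \<X>" "\<And>j k. elem_equidec \<X> (\<sigma> j k) (\<rho> j k)"
    "\<And>j. \<Theta> j = fsum (\<sigma> j)"
    by metis
  show thesis
  proof (rule that[rule_format])
    show "fsum (\<lambda>j. \<sigma> j k) \<in> count_funs \<X>" for k
      using \<sigma>(1) by (rule count_funs_fsum)
    show "\<phi> = fsum (\<lambda>k. fsum (\<lambda>j. \<sigma> j k))"
      unfolding 1(4) by (subst fsum_swap) (simp add: \<sigma>(3)[symmetric])
    show "fun_equidec \<X> (fsum (\<lambda>j. \<sigma> j k)) (\<Psi> k)" for k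
      unfolding \<rho>(3) using \<rho>(1) \<sigma>(1,2) by (intro fun_equidec_fsum fun_equidec_elem)
  qed
qed

text \<open>
  Splitting along the pieces \<open>\<Theta>\<close> of the second equidecomposition reduces the claim to the case that the
  second one is a single step \<open>\<Theta> k\<close> to \<open>\<Lambda> k\<close>. This step is split along the pieces \<open>B\<close> of the
  first one, after which single steps can be composed.
\<close>
lemma fun_equidec_trans:
  assumes "fun_equidec \<X> \<phi> \<psi>" "fun_equidec \<X> \<psi> \<omega>"
  shows "fun_equidec \<X> \<phi> \<omega>"
proof -
  obtain \<Theta> \<Lambda> where "\<forall>j. \<Theta> j \<in> count_funs \<X>" "\<forall>j. \<Lambda> j \<in> count_funs \<X>"
    "\<forall>j. elem_equidec \<X> (\<Theta> j) (\<Lambda> j)" and \<psi>: "\<psi> = fsum \<Theta>" and \<omega>: "\<omega> = fsum \<Lambda>"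
    by (rule fun_equidecE[OF assms(2)])
  note 1 = this(1-3)[rule_format]
  obtain \<Phi> where "\<forall>k. \<Phi> k \<in> count_funs \<X>" and \<phi>: "\<phi> = fsum \<Phi>"
    and "\<forall>k. fun_equidec \<X> (\<Phi> k) (\<Theta> k)"
    by (rule fun_equidec_split[OF assms(1)[unfolded \<psi>] 1(1)])
  note 2 = this(3)[rule_format]
  have "fun_equidec \<X> (\<Phi> k) (\<Lambda> k)" for k
  proof -
    obtain A B where "\<forall>j. A j \<in> count_funs \<X>" "\<forall>j. B j \<in> count_funs \<X>"
      "\<forall>j. elem_equidec \<X> (A j) (B j)" and AB: "\<Phi> k = fsum A" "\<Theta> k = fsum B"
      by (rule fun_equidecE[OF 2])
    note 3 = this(1-3)[rule_format]
    have "elem_equidec \<X> (\<Lambda> k) (fsum B)"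
      unfolding AB(2)[symmetric] using 1(3) by (rule elem_equidec_sym)
    then obtain C where "\<forall>j. C j \<in> count_funs \<X>" and C: "\<Lambda> k = fsum C"
      and "\<forall>j. elem_equidec \<X> (C j) (B j)"
      by (rule elem_equidec_split[OF 1(2) 3(2)])
    note 4 = this(1,3)[rule_format]
    show ?thesis
      by (rule fun_equidecI[OF 3(1) 4(1) _ AB(1) C])
         (rule elem_equidec_trans[OF 3(3) elem_equidec_sym[OF 4(2)]])
  qed
  then show ?thesis
    unfolding \<phi> \<omega> by (rule fun_equidec_fsum)
qed

text \<open>
  Equidecomposability of coproducts only depends on their count functions, because equality of
  coproducts does.
\<close>
lemma equidec_iff_fun_equidec:
  "(P, Q) \<in> equidec \<X> \<longleftrightarrow>
    P \<in> coprods \<X> \<and> Q \<in> coprods \<X> \<and> fun_equidec \<X> (fibre_count P) (fibre_count Q)"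
proof safe
  assume "(P, Q) \<in> equidec \<X>"
  then show "P \<in> coprods \<X>" "Q \<in> coprods \<X>"
    by (simp_all add: equidec_def)
  from \<open>(P, Q) \<in> equidec \<X>\<close> obtain Ps Qs s t where *: "\<forall>j. Ps j \<in> coprods \<X> \<and> Qs j \<in> coprods \<X> \<and>
      s j \<in> carrier (monoid_of \<X>) \<and> t j \<in> carrier (monoid_of \<X>)"
    "(P, Coprod Ps) \<in> same_coprod \<X>" "(Q, Coprod Qs) \<in> same_coprod \<X>"
    "\<forall>j. (coprod_preim \<X> (s j) (Ps j), coprod_preim \<X> (t j) (Qs j)) \<in> same_coprod \<X>"
    by (auto simp only: equidec_def mem_Collect_eq case_prod_conv)
  then have "fibre_count P = fsum (\<lambda>j. fibre_count (Ps j))"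
    "fibre_count Q = fsum (\<lambda>j. fibre_count (Qs j))"
    "pull \<X> (s j) (fibre_count (Ps j)) = pull \<X> (t j) (fibre_count (Qs j))" for j
    by (simp_all add: same_coprod_iff fibre_count_Coprod fibre_count_coprod_preim)
  moreover have "fibre_count (Ps j) \<in> count_funs \<X>" "fibre_count (Qs j) \<in> count_funs \<X>" for j
    using * unfolding count_funs_def by auto
  ultimately show "fun_equidec \<X> (fibre_count P) (fibre_count Q)"
    unfolding fun_equidec_def elem_equidec_def using *(1)
    by (intro exI[of _ "\<lambda>j. fibre_count (Ps j)"] exI[of _ "\<lambda>j. fibre_count (Qs j)"]) blast
next
  assume PQ: "P \<in> coprods \<X>" "Q \<in> coprods \<X>"
    and "fun_equidec \<X> (fibre_count P) (fibre_count Q)"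
  then obtain \<Phi> \<Psi> where \<Phi>: "\<And>j. \<Phi> j \<in> count_funs \<X>" and \<Psi>: "\<And>j. \<Psi> j \<in> count_funs \<X>"
    and elem: "\<And>j. elem_equidec \<X> (\<Phi> j) (\<Psi> j)"
    and sums: "fibre_count P = fsum \<Phi>" "fibre_count Q = fsum \<Psi>"
    unfolding fun_equidec_def by blast
  obtain Ps where Ps: "\<And>j. Ps j \<in> coprods \<X>" "\<And>j. \<Phi> j = fibre_count (Ps j)"
    using \<Phi> unfolding count_funs_def image_iff by metis
  obtain Qs where Qs: "\<And>j. Qs j \<in> coprods \<X>" "\<And>j. \<Psi> j = fibre_count (Qs j)"
    using \<Psi> unfolding count_funs_def image_iff by metis
  obtain s t where st: "\<And>j. s j \<in> carrier (monoid_of \<X>)" "\<And>j. t j \<in> carrier (monoid_of \<X>)"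
    "\<And>j. pull \<X> (s j) (\<Phi> j) = pull \<X> (t j) (\<Psi> j)"
    using elem unfolding elem_equidec_def Bex_def by metis
  have "Coprod Ps \<in> coprods \<X>" "Coprod Qs \<in> coprods \<X>"
    using Ps(1) Qs(1) by (auto intro: Coprod_coprods)
  moreover have "fibre_count P = fibre_count (Coprod Ps)" "fibre_count Q = fibre_count (Coprod Qs)"
    by (simp_all add: sums fibre_count_Coprod Ps(2)[symmetric] Qs(2)[symmetric])
  ultimately have "(P, Coprod Ps) \<in> same_coprod \<X>" "(Q, Coprod Qs) \<in> same_coprod \<X>"
    using PQ by (simp_all add: same_coprod_iff)
  moreover have "(coprod_preim \<X> (s j) (Ps j), coprod_preim \<X> (t j) (Qs j)) \<in> same_coprod \<X>" for j
    using st Ps Qs by (simp add: same_coprod_iff fibre_count_coprod_preim coprod_preim_coprods)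
  ultimately show "(P, Q) \<in> equidec \<X>"
    unfolding equidec_def mem_Collect_eq case_prod_conv using PQ Ps(1) Qs(1) st(1,2) by blast
qed

lemma equiv_equidec: "equiv (coprods \<X>) (equidec \<X>)"
proof (rule equivI)
  show "refl_on (coprods \<X>) (equidec \<X>)"
    by (auto intro!: refl_onI fun_equidec_refl simp: equidec_iff_fun_equidec count_funs_def)
  show "sym (equidec \<X>)"
    unfolding sym_def equidec_iff_fun_equidec using fun_equidec_sym by blast
  show "trans (equidec \<X>)"
    unfolding trans_def equidec_iff_fun_equidec using fun_equidec_trans by blast
qed (auto simp: equidec_iff_fun_equidec)

end


section \<open>The type monoid is a cardinal algebra\<close>

text \<open>
  The element of the type monoid represented by the count function \<open>\<phi>\<close>. Presenting types in this way
  turns the operations on classes into pointwise operations on functions.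
\<close>
definition fun_type :: "('x, 's) stat_space \<Rightarrow> ('x \<Rightarrow> ennreal) \<Rightarrow> (nat \<Rightarrow> 'x set) set" where
  "fun_type \<X> \<phi> = {P \<in> coprods \<X>. fun_equidec \<X> \<phi> (fibre_count P)}"

context stat_meas_space
begin

lemma equidec_class_eq_fun_type:
  "P \<in> coprods \<X> \<Longrightarrow> equidec_class \<X> P = fun_type \<X> (fibre_count P)"
  unfolding equidec_class_def fun_type_def by (auto simp: equidec_iff_fun_equidec)

lemma fun_type_cong: "fun_equidec \<X> \<phi> \<psi> \<Longrightarrow> fun_type \<X> \<phi> = fun_type \<X> \<psi>"
  unfolding fun_type_def using fun_equidec_trans fun_equidec_sym by blast

lemma fun_type_nonempty:
  assumes "\<phi> \<in> count_funs \<X>"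
  obtains P where "P \<in> fun_type \<X> \<phi>"
proof -
  obtain P where "P \<in> coprods \<X>" "\<phi> = fibre_count P"
    using assms unfolding count_funs_def by blast
  then show thesis
    using fun_equidec_refl[OF assms] by (intro that[of P]) (simp add: fun_type_def)
qed

lemma fun_typeD:
  "P \<in> fun_type \<X> \<phi> \<Longrightarrow> P \<in> coprods \<X>"
  "P \<in> fun_type \<X> \<phi> \<Longrightarrow> fun_equidec \<X> (fibre_count P) \<phi>"
  unfolding fun_type_def using fun_equidec_sym by auto

lemma fun_type_eq_iff:
  assumes "\<phi> \<in> count_funs \<X>" "\<psi> \<in> count_funs \<X>"
  shows "fun_type \<X> \<phi> = fun_type \<X> \<psi> \<longleftrightarrow> fun_equidec \<X> \<phi> \<psi>"
proof
  assume eq: "fun_type \<X> \<phi> = fun_type \<X> \<psi>"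
  obtain P where "P \<in> fun_type \<X> \<phi>"
    by (rule fun_type_nonempty[OF assms(1)])
  then show "fun_equidec \<X> \<phi> \<psi>"
    using eq fun_typeD(2) fun_equidec_sym fun_equidec_trans by metis
qed (rule fun_type_cong)

lemma carrier_type_monoid: "carrier (type_monoid \<X>) = fun_type \<X> ` count_funs \<X>"
proof -
  have "carrier (type_monoid \<X>) = equidec_class \<X> ` coprods \<X>"
    unfolding type_monoid_def quotient_def equidec_class_def by auto
  also have "\<dots> = fun_type \<X> ` count_funs \<X>"
    unfolding count_funs_def image_image by (intro image_cong) (simp_all add: equidec_class_eq_fun_type)
  finally show ?thesis .
qed

lemma one_type_monoid: "\<one>\<^bsub>type_monoid \<X>\<^esub> = fun_type \<X> (\<lambda>_. 0)"
proof -
  have "indicator {} = (\<lambda>_ :: 'x. 0 :: ennreal)"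
    by (auto simp: fun_eq_iff)
  then show ?thesis
    by (simp add: type_monoid_def equidec_class_eq_fun_type single_coprods fibre_count_single)
qed

lemma fun_type_fadd:
  assumes "\<phi> \<in> count_funs \<X>" "\<psi> \<in> count_funs \<X>"
  shows "fun_type \<X> \<phi> \<otimes>\<^bsub>type_monoid \<X>\<^esub> fun_type \<X> \<psi> = fun_type \<X> (fadd \<phi> \<psi>)"
proof -
  have "equidec_class \<X> (coprod2 P Q) = fun_type \<X> (fadd \<phi> \<psi>)"
    if "P \<in> fun_type \<X> \<phi>" "Q \<in> fun_type \<X> \<psi>" for P Q
    using fun_typeD[OF that(1)] fun_typeD[OF that(2)]
    by (simp add: equidec_class_eq_fun_type coprod2_coprods fibre_count_coprod2
          fun_type_cong fun_equidec_fadd)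
  moreover obtain P Q where "P \<in> fun_type \<X> \<phi>" "Q \<in> fun_type \<X> \<psi>"
    using fun_type_nonempty assms by metis
  ultimately have "(\<Union>P\<in>fun_type \<X> \<phi>. \<Union>Q\<in>fun_type \<X> \<psi>. equidec_class \<X> (coprod2 P Q)) =
      fun_type \<X> (fadd \<phi> \<psi>)"
    by auto
  then show ?thesis
    by (simp add: type_monoid_def)
qed

lemma fun_type_fsum:
  assumes "\<And>i. \<Phi> i \<in> count_funs \<X>"
  shows "type_sum \<X> (\<lambda>i. fun_type \<X> (\<Phi> i)) = fun_type \<X> (fsum \<Phi>)"
proof -
  have "equidec_class \<X> (Coprod P) = fun_type \<X> (fsum \<Phi>)"
    if "\<And>i. P i \<in> fun_type \<X> (\<Phi> i)" for P
    using fun_typeD[OF that]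
    by (simp add: equidec_class_eq_fun_type Coprod_coprods fibre_count_Coprod
          fun_type_cong fun_equidec_fsum)
  moreover have "\<exists>P. \<forall>i. P i \<in> fun_type \<X> (\<Phi> i)"
  proof -
    have "\<forall>i. \<exists>P. P \<in> fun_type \<X> (\<Phi> i)"
      using fun_type_nonempty[OF assms] by metis
    then show ?thesis
      by (rule choice)
  qed
  ultimately show ?thesis
    unfolding type_sum_def by auto
qed

lemma carrier_type_monoidE:
  assumes "\<alpha> \<in> carrier (type_monoid \<X>)"
  obtains \<phi> where "\<phi> \<in> count_funs \<X>" "\<alpha> = fun_type \<X> \<phi>"
  using assms unfolding carrier_type_monoid by blast

lemma carrier_type_monoid_seqE:
  assumes "\<And>i. a i \<in> carrier (type_monoid \<X>)"
  obtains \<Phi> where "\<forall>i. \<Phi> i \<in> count_funs \<X>" "a = (\<lambda>i. fun_type \<X> (\<Phi> i))"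
proof -
  have "\<forall>i. \<exists>\<phi>. \<phi> \<in> count_funs \<X> \<and> a i = fun_type \<X> \<phi>"
    using assms unfolding carrier_type_monoid by blast
  then obtain \<Phi> where "\<forall>i. \<Phi> i \<in> count_funs \<X> \<and> a i = fun_type \<X> (\<Phi> i)"
    by metis
  then show thesis
    by (intro that[of \<Phi>]) auto
qed

lemma fun_type_closed: "\<phi> \<in> count_funs \<X> \<Longrightarrow> fun_type \<X> \<phi> \<in> carrier (type_monoid \<X>)"
  unfolding carrier_type_monoid by blast

lemma fun_equidec_split_fadd:
  assumes "fun_equidec \<X> \<phi> (fadd \<psi> \<omega>)" "\<psi> \<in> count_funs \<X>" "\<omega> \<in> count_funs \<X>"
  obtains \<psi>' \<omega>' where "\<psi>' \<in> count_funs \<X>" "\<omega>' \<in> count_funs \<X>" "\<phi> = fadd \<psi>' \<omega>'"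
    "fun_equidec \<X> \<psi>' \<psi>" "fun_equidec \<X> \<omega>' \<omega>"
proof -
  obtain \<Phi> where "\<forall>k. \<Phi> k \<in> count_funs \<X>" and \<phi>: "\<phi> = fsum \<Phi>"
    and "\<forall>k. fun_equidec \<X> (\<Phi> k) (pair_seq \<psi> \<omega> k)"
    by (rule fun_equidec_split[of \<phi> "pair_seq \<psi> \<omega>"]) (use assms in \<open>simp_all add: fsum_pair_seq count_funs_pair_seq\<close>)
  note \<Phi> = this(1,3)[rule_format]
  show thesis
  proof (rule that[of "\<Phi> 0" "fsum (\<lambda>i. \<Phi> (Suc i))"])
    show "fsum (\<lambda>i. \<Phi> (Suc i)) \<in> count_funs \<X>"
      using \<Phi>(1) by (rule count_funs_fsum)
    show "\<phi> = fadd (\<Phi> 0) (fsum (\<lambda>i. \<Phi> (Suc i)))"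
      unfolding \<phi> by (rule fsum_Suc)
    show "fun_equidec \<X> (\<Phi> 0) \<psi>"
      using \<Phi>(2)[of 0] by (simp add: pair_seq_def)
    have "fun_equidec \<X> (fsum (\<lambda>i. \<Phi> (Suc i))) (fsum (\<lambda>i. pair_seq \<psi> \<omega> (Suc i)))"
      using \<Phi>(2) by (rule fun_equidec_fsum)
    then show "fun_equidec \<X> (fsum (\<lambda>i. \<Phi> (Suc i))) \<omega>"
      by (simp add: fsum_pair_seq_tail)
  qed (rule \<Phi>(1))
qed

text \<open>
  The binary case of the countable refinement: the rows and columns beyond the first are put together,
  so that the second summand takes over all zeros of the padding.
\<close>
lemma fadd_refinement:
  assumes "\<phi> \<in> count_funs \<X>" "\<psi> \<in> count_funs \<X>" "\<phi>' \<in> count_funs \<X>" "\<psi>' \<in> count_funs \<X>"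
    "fadd \<phi> \<psi> = fadd \<phi>' \<psi>'"
  obtains p q r s where "p \<in> count_funs \<X>" "q \<in> count_funs \<X>" "r \<in> count_funs \<X>" "s \<in> count_funs \<X>"
    "\<phi> = fadd p q" "\<psi> = fadd r s" "\<phi>' = fadd p r" "\<psi>' = fadd q s"
proof -
  have eq: "fsum (pair_seq \<phi> \<psi>) = fsum (pair_seq \<phi>' \<psi>')"
    using assms(5) by (simp add: fsum_pair_seq)
  obtain \<rho> where "\<forall>i j. \<rho> i j \<in> count_funs \<X>" "\<forall>i. pair_seq \<phi> \<psi> i = fsum (\<lambda>j. \<rho> i j)"
    "\<forall>j. pair_seq \<phi>' \<psi>' j = fsum (\<lambda>i. \<rho> i j)"
    by (rule fsum_refinement[OF count_funs_pair_seq[OF assms(1,2)] count_funs_pair_seq[OF assms(3,4)] eq])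
  note \<rho> = this[rule_format]
  define q where "q = fsum (\<lambda>j. \<rho> 0 (Suc j))"
  define r where "r = fsum (\<lambda>i. \<rho> (Suc i) 0)"
  define s where "s = fsum (\<lambda>i. fsum (\<lambda>j. \<rho> (Suc i) (Suc j)))"
  show thesis
  proof (rule that)
    show "\<rho> 0 0 \<in> count_funs \<X>" "q \<in> count_funs \<X>" "r \<in> count_funs \<X>" "s \<in> count_funs \<X>"
      unfolding q_def r_def s_def by (intro count_funs_fsum \<rho>(1))+
    have "\<phi> = fsum (\<lambda>j. \<rho> 0 j)"
      using \<rho>(2)[of 0] by (simp add: pair_seq_def)
    then show "\<phi> = fadd (\<rho> 0 0) q"
      unfolding q_def by (subst (asm) fsum_Suc)
    have "\<phi>' = fsum (\<lambda>i. \<rho> i 0)"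
      using \<rho>(3)[of 0] by (simp add: pair_seq_def)
    then show "\<phi>' = fadd (\<rho> 0 0) r"
      unfolding r_def by (subst (asm) fsum_Suc)
    have "\<psi> = fsum (\<lambda>i. fsum (\<lambda>j. \<rho> (Suc i) j))"
      using fsum_pair_seq_tail[of \<phi> \<psi>] by (simp add: \<rho>(2))
    also have "\<dots> = fsum (\<lambda>i. fadd (\<rho> (Suc i) 0) (fsum (\<lambda>j. \<rho> (Suc i) (Suc j))))"
      by (subst (2) fsum_Suc) (rule refl)
    finally show "\<psi> = fadd r s"
      unfolding r_def s_def fsum_fadd .
    have "\<psi>' = fsum (\<lambda>j. fsum (\<lambda>i. \<rho> i (Suc j)))"
      using fsum_pair_seq_tail[of \<phi>' \<psi>'] by (simp add: \<rho>(3))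
    also have "\<dots> = fsum (\<lambda>j. fadd (\<rho> 0 (Suc j)) (fsum (\<lambda>i. \<rho> (Suc i) (Suc j))))"
      by (subst (2) fsum_Suc) (rule refl)
    also have "\<dots> = fadd q (fsum (\<lambda>j. fsum (\<lambda>i. \<rho> (Suc i) (Suc j))))"
      unfolding q_def fsum_fadd ..
    finally show "\<psi>' = fadd q s"
      unfolding s_def by (subst fsum_swap)
  qed
qed

text \<open>
  Splitting replaces the functions \<open>\<Phi> n\<close>, one after the other, by equidecomposable functions \<open>\<Theta> n\<close> for
  which the recursion holds as an equation, and these have a limit.
\<close>
lemma fun_equidec_remainder:
  assumes \<Phi>: "\<And>n. \<Phi> n \<in> count_funs \<X>" and \<Gamma>: "\<And>n. \<Gamma> n \<in> count_funs \<X>"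
    and step: "\<And>n. fun_equidec \<X> (\<Phi> n) (fadd (\<Gamma> n) (\<Phi> (Suc n)))"
  obtains \<kappa> where "\<kappa> \<in> count_funs \<X>"
    "\<forall>n. fun_equidec \<X> (\<Phi> n) (fadd \<kappa> (fsum (\<lambda>i. \<Gamma> (n + i))))"
proof -
  have "\<exists>\<Theta>. \<forall>n. (\<Theta> n \<in> count_funs \<X> \<and> fun_equidec \<X> (\<Theta> n) (\<Phi> n)) \<and>
    (\<exists>\<gamma>\<in>count_funs \<X>. fun_equidec \<X> \<gamma> (\<Gamma> n) \<and> \<Theta> n = fadd \<gamma> (\<Theta> (Suc n)))"
  proof (rule dependent_nat_choice)
    show "\<exists>\<theta>. \<theta> \<in> count_funs \<X> \<and> fun_equidec \<X> \<theta> (\<Phi> 0)"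
      using \<Phi> fun_equidec_refl by blast
    fix \<theta> n
    assume "\<theta> \<in> count_funs \<X> \<and> fun_equidec \<X> \<theta> (\<Phi> n)"
    then have "fun_equidec \<X> \<theta> (fadd (\<Gamma> n) (\<Phi> (Suc n)))"
      using step fun_equidec_trans by blast
    then obtain \<gamma> \<theta>' where "\<gamma> \<in> count_funs \<X>" "\<theta>' \<in> count_funs \<X>" "\<theta> = fadd \<gamma> \<theta>'"
      "fun_equidec \<X> \<gamma> (\<Gamma> n)" "fun_equidec \<X> \<theta>' (\<Phi> (Suc n))"
      by (rule fun_equidec_split_fadd[OF _ \<Gamma> \<Phi>])
    then show "\<exists>\<theta>'. (\<theta>' \<in> count_funs \<X> \<and> fun_equidec \<X> \<theta>' (\<Phi> (Suc n))) \<and>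
        (\<exists>\<gamma>\<in>count_funs \<X>. fun_equidec \<X> \<gamma> (\<Gamma> n) \<and> \<theta> = fadd \<gamma> \<theta>')"
      by blast
  qed
  then obtain \<Theta> where \<Theta>: "\<And>n. \<Theta> n \<in> count_funs \<X>" "\<And>n. fun_equidec \<X> (\<Theta> n) (\<Phi> n)"
    and ex: "\<And>n. \<exists>\<gamma>. \<gamma> \<in> count_funs \<X> \<and> fun_equidec \<X> \<gamma> (\<Gamma> n) \<and> \<Theta> n = fadd \<gamma> (\<Theta> (Suc n))"
    by metis
  obtain \<Gamma>' where \<Gamma>': "\<And>n. \<Gamma>' n \<in> count_funs \<X>" "\<And>n. fun_equidec \<X> (\<Gamma>' n) (\<Gamma> n)"
    "\<And>n. \<Theta> n = fadd (\<Gamma>' n) (\<Theta> (Suc n))"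
    using ex by metis
  obtain \<kappa> where \<kappa>: "\<kappa> \<in> count_funs \<X>" "\<forall>n. \<Theta> n = fadd \<kappa> (fsum (\<lambda>i. \<Gamma>' (n + i)))"
    by (rule fsum_remainder[of \<Theta> \<X> \<Gamma>', OF \<Theta>(1) \<Gamma>'(1) \<Gamma>'(3)])
  have "fun_equidec \<X> (\<Phi> n) (fadd \<kappa> (fsum (\<lambda>i. \<Gamma> (n + i))))" for n
  proof (rule fun_equidec_trans[OF fun_equidec_sym[OF \<Theta>(2)]])
    have "fun_equidec \<X> (fsum (\<lambda>i. \<Gamma>' (n + i))) (fsum (\<lambda>i. \<Gamma> (n + i)))"
      using \<Gamma>'(2) by (rule fun_equidec_fsum)
    then have "fun_equidec \<X> (fadd \<kappa> (fsum (\<lambda>i. \<Gamma>' (n + i)))) (fadd \<kappa> (fsum (\<lambda>i. \<Gamma> (n + i))))"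
      by (rule fun_equidec_fadd[OF fun_equidec_refl[OF \<kappa>(1)]])
    then show "fun_equidec \<X> (\<Theta> n) (fadd \<kappa> (fsum (\<lambda>i. \<Gamma> (n + i))))"
      using \<kappa>(2)[rule_format, of n] by simp
  qed
  then show thesis
    using \<kappa>(1) that by blast
qed

lemma comm_monoid_type_monoid: "comm_monoid (type_monoid \<X>)"
proof (rule comm_monoidI)
  show "\<one>\<^bsub>type_monoid \<X>\<^esub> \<in> carrier (type_monoid \<X>)"
    unfolding one_type_monoid by (intro fun_type_closed count_funs_zero)
next
  fix \<alpha> \<beta> assume "\<alpha> \<in> carrier (type_monoid \<X>)" "\<beta> \<in> carrier (type_monoid \<X>)"
  then obtain \<phi> \<psi> where "\<phi> \<in> count_funs \<X>" "\<psi> \<in> count_funs \<X>" "\<alpha> = fun_type \<X> \<phi>" "\<beta> = fun_type \<X> \<psi>"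
    by (metis carrier_type_monoidE)
  moreover have "fadd \<phi> \<psi> = fadd \<psi> \<phi>"
    by (simp add: fadd_def add.commute)
  ultimately show "\<alpha> \<otimes>\<^bsub>type_monoid \<X>\<^esub> \<beta> \<in> carrier (type_monoid \<X>)"
    "\<alpha> \<otimes>\<^bsub>type_monoid \<X>\<^esub> \<beta> = \<beta> \<otimes>\<^bsub>type_monoid \<X>\<^esub> \<alpha>"
    by (simp_all add: fun_type_fadd fun_type_closed count_funs_fadd)
next
  fix \<alpha> \<beta> \<gamma>
  assume "\<alpha> \<in> carrier (type_monoid \<X>)" "\<beta> \<in> carrier (type_monoid \<X>)" "\<gamma> \<in> carrier (type_monoid \<X>)"
  then obtain \<phi> \<psi> \<omega> where "\<phi> \<in> count_funs \<X>" "\<psi> \<in> count_funs \<X>" "\<omega> \<in> count_funs \<X>"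
    "\<alpha> = fun_type \<X> \<phi>" "\<beta> = fun_type \<X> \<psi>" "\<gamma> = fun_type \<X> \<omega>"
    by (metis carrier_type_monoidE)
  moreover have "fadd (fadd \<phi> \<psi>) \<omega> = fadd \<phi> (fadd \<psi> \<omega>)"
    by (simp add: fadd_def add.assoc)
  ultimately show "\<alpha> \<otimes>\<^bsub>type_monoid \<X>\<^esub> \<beta> \<otimes>\<^bsub>type_monoid \<X>\<^esub> \<gamma> =
      \<alpha> \<otimes>\<^bsub>type_monoid \<X>\<^esub> (\<beta> \<otimes>\<^bsub>type_monoid \<X>\<^esub> \<gamma>)"
    by (simp add: fun_type_fadd count_funs_fadd)
next
  fix \<alpha> assume "\<alpha> \<in> carrier (type_monoid \<X>)"
  then obtain \<phi> where "\<phi> \<in> count_funs \<X>" "\<alpha> = fun_type \<X> \<phi>"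
    by (rule carrier_type_monoidE)
  then show "\<one>\<^bsub>type_monoid \<X>\<^esub> \<otimes>\<^bsub>type_monoid \<X>\<^esub> \<alpha> = \<alpha>"
    by (simp add: one_type_monoid fun_type_fadd count_funs_zero fadd_zero)
qed

text \<open>
  Refinement and the remainder property hold for functions; splitting transfers them to types.
\<close>
sublocale type: cardinal_algebra "type_monoid \<X>" "type_sum \<X>"
proof (intro cardinal_algebra.intro comm_monoid_type_monoid cardinal_algebra_axioms.intro)
  let ?T = "type_monoid \<X>"
  fix f :: "nat \<Rightarrow> (nat \<Rightarrow> 'x set) set"
  assume "\<And>i. f i \<in> carrier ?T"
  then obtain \<Phi> where "\<forall>i. \<Phi> i \<in> count_funs \<X>" and f: "f = (\<lambda>i. fun_type \<X> (\<Phi> i))"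
    by (rule carrier_type_monoid_seqE)
  note \<Phi> = this(1)[rule_format]
  show "type_sum \<X> f \<in> carrier ?T"
    using \<Phi> by (simp add: f fun_type_fsum fun_type_closed count_funs_fsum)
  show "type_sum \<X> f = f 0 \<otimes>\<^bsub>?T\<^esub> type_sum \<X> (\<lambda>i. f (Suc i))"
    using \<Phi> fsum_Suc[of \<Phi>] by (simp add: f fun_type_fsum fun_type_fadd count_funs_fsum)
  fix g :: "nat \<Rightarrow> (nat \<Rightarrow> 'x set) set"
  assume "\<And>i. g i \<in> carrier ?T"
  then obtain \<Psi> where "\<forall>i. \<Psi> i \<in> count_funs \<X>" and g: "g = (\<lambda>i. fun_type \<X> (\<Psi> i))"
    by (rule carrier_type_monoid_seqE)
  note \<Psi> = this(1)[rule_format]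
  show "type_sum \<X> (\<lambda>i. f i \<otimes>\<^bsub>?T\<^esub> g i) = type_sum \<X> f \<otimes>\<^bsub>?T\<^esub> type_sum \<X> g"
    using \<Phi> \<Psi> by (simp add: f g fun_type_fsum fun_type_fadd count_funs_fsum count_funs_fadd fsum_fadd)
  assume "\<And>n. f n = g n \<otimes>\<^bsub>?T\<^esub> f (Suc n)"
  then have step: "fun_equidec \<X> (\<Phi> n) (fadd (\<Psi> n) (\<Phi> (Suc n)))" for n
    using \<Phi> \<Psi> unfolding f g by (simp add: fun_type_fadd fun_type_eq_iff count_funs_fadd)
  obtain \<kappa> where \<kappa>: "\<kappa> \<in> count_funs \<X>"
    "\<forall>n. fun_equidec \<X> (\<Phi> n) (fadd \<kappa> (fsum (\<lambda>i. \<Psi> (n + i))))"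
    by (rule fun_equidec_remainder[of \<Phi> \<Psi>, OF \<Phi> \<Psi> step])
  then show "\<exists>c\<in>carrier ?T. \<forall>n. f n = c \<otimes>\<^bsub>?T\<^esub> type_sum \<X> (\<lambda>i. g (n + i))"
    using \<Phi> \<Psi> by (intro bexI[of _ "fun_type \<X> \<kappa>"])
      (simp_all add: f g fun_type_closed fun_type_fsum fun_type_fadd fun_type_eq_iff
        count_funs_fsum count_funs_fadd)
next
  let ?T = "type_monoid \<X>"
  fix a b c d
  assume "a \<in> carrier ?T" "b \<in> carrier ?T" "c \<in> carrier ?T" "d \<in> carrier ?T"
    and eq: "a \<otimes>\<^bsub>?T\<^esub> b = c \<otimes>\<^bsub>?T\<^esub> d"
  then obtain \<alpha> \<beta> \<gamma> \<delta> where funs: "\<alpha> \<in> count_funs \<X>" "\<beta> \<in> count_funs \<X>" "\<gamma> \<in> count_funs \<X>" "\<delta> \<in> count_funs \<X>"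
    and types: "a = fun_type \<X> \<alpha>" "b = fun_type \<X> \<beta>" "c = fun_type \<X> \<gamma>" "d = fun_type \<X> \<delta>"
    by (metis carrier_type_monoidE)
  have "fun_equidec \<X> (fadd \<alpha> \<beta>) (fadd \<gamma> \<delta>)"
    using eq funs unfolding types by (simp add: fun_type_fadd fun_type_eq_iff count_funs_fadd)
  then obtain \<gamma>' \<delta>' where 1: "\<gamma>' \<in> count_funs \<X>" "\<delta>' \<in> count_funs \<X>" "fadd \<alpha> \<beta> = fadd \<gamma>' \<delta>'"
    "fun_equidec \<X> \<gamma>' \<gamma>" "fun_equidec \<X> \<delta>' \<delta>"
    by (rule fun_equidec_split_fadd[OF _ funs(3,4)])
  obtain p q r s where 2: "p \<in> count_funs \<X>" "q \<in> count_funs \<X>" "r \<in> count_funs \<X>" "s \<in> count_funs \<X>"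
    "\<alpha> = fadd p q" "\<beta> = fadd r s" "\<gamma>' = fadd p r" "\<delta>' = fadd q s"
    by (rule fadd_refinement[OF funs(1,2) 1(1-3)])
  have "a = fun_type \<X> p \<otimes>\<^bsub>?T\<^esub> fun_type \<X> q" "b = fun_type \<X> r \<otimes>\<^bsub>?T\<^esub> fun_type \<X> s"
    "c = fun_type \<X> p \<otimes>\<^bsub>?T\<^esub> fun_type \<X> r" "d = fun_type \<X> q \<otimes>\<^bsub>?T\<^esub> fun_type \<X> s"
    using 2 fun_type_cong[OF 1(4)] fun_type_cong[OF 1(5)] unfolding types
    by (simp_all add: fun_type_fadd)
  then show "\<exists>p\<in>carrier ?T. \<exists>q\<in>carrier ?T. \<exists>r\<in>carrier ?T. \<exists>s\<in>carrier ?T.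
      a = p \<otimes>\<^bsub>?T\<^esub> q \<and> b = r \<otimes>\<^bsub>?T\<^esub> s \<and> c = p \<otimes>\<^bsub>?T\<^esub> r \<and> d = q \<otimes>\<^bsub>?T\<^esub> s"
    using fun_type_closed 2(1-4) by blast
qed

end


section \<open>Functoriality\<close>

definition pull_along :: "('x, 's) stat_space \<Rightarrow> ('x \<Rightarrow> 'y) \<Rightarrow> ('y \<Rightarrow> ennreal) \<Rightarrow> 'x \<Rightarrow> ennreal" where
  "pull_along \<X> f \<phi> = (\<lambda>x. if x \<in> space (meas \<X>) then \<phi> (f x) else 0)"

lemma pull_along_fsum: "pull_along \<X> f (fsum \<Phi>) = fsum (\<lambda>j. pull_along \<X> f (\<Phi> j))"
  unfolding pull_along_def fsum_def by auto

lemma pull_along_fadd: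
  "pull_along \<X> f (fadd \<phi> \<psi>) = fadd (pull_along \<X> f \<phi>) (pull_along \<X> f \<psi>)"
  unfolding pull_along_def fadd_def by auto

lemma pull_along_zero: "pull_along \<X> f (\<lambda>_. 0) = (\<lambda>_. 0)"
  unfolding pull_along_def by auto

lemma fibre_count_coprod_morph_preim:
  "fibre_count (coprod_morph_preim \<X> f P) = pull_along \<X> f (fibre_count P)"
proof
  show "fibre_count (coprod_morph_preim \<X> f P) x = pull_along \<X> f (fibre_count P) x" for x
    by (cases "x \<in> space (meas \<X>)")
       (simp_all add: fibre_count_def coprod_morph_preim_def morph_preim_def pull_along_def indicator_def)
qed

text \<open>
  A morphism together with one choice of a homomorphism \<open>h\<close> making it equivariant.
\<close>
locale stat_meas_morphism = source: stat_meas_space \<X> + target: stat_meas_space \<Y>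
  for \<X> :: "('x, 's) stat_space" and \<Y> :: "('y, 't) stat_space" +
  fixes f :: "'x \<Rightarrow> 'y" and h :: "'t \<Rightarrow> 's"
  assumes f_measurable: "f \<in> meas \<X> \<rightarrow>\<^sub>M meas \<Y>"
    and h_hom: "h \<in> monoid_hom (monoid_of \<Y>) (monoid_of \<X>)"
    and equivariant: "t \<in> carrier (monoid_of \<Y>) \<Longrightarrow> B \<in> sets (meas \<Y>) \<Longrightarrow>
      morph_preim \<X> f (preim \<Y> t B) = preim \<X> (h t) (morph_preim \<X> f B)"

lemma stat_morphism_iff: "stat_morphism \<X> \<Y> f \<longleftrightarrow> (\<exists>h. stat_meas_morphism \<X> \<Y> f h)"
  unfolding stat_morphism_def stat_meas_morphism_def stat_meas_morphism_axioms_def by blast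

context stat_meas_morphism
begin

lemma h_closed: "t \<in> carrier (monoid_of \<Y>) \<Longrightarrow> h t \<in> carrier (monoid_of \<X>)"
  using h_hom by (auto simp: monoid_hom_def hom_def)

lemma f_space: "x \<in> space (meas \<X>) \<Longrightarrow> f x \<in> space (meas \<Y>)"
  using measurable_space[OF f_measurable] .

lemma morph_preim_sets: "B \<in> sets (meas \<Y>) \<Longrightarrow> morph_preim \<X> f B \<in> sets (meas \<X>)"
  unfolding morph_preim_def using measurable_sets[OF f_measurable] .

lemma coprod_morph_preim_coprods: "B \<in> coprods \<Y> \<Longrightarrow> coprod_morph_preim \<X> f B \<in> coprods \<X>"
  by (simp add: coprods_def coprod_morph_preim_def morph_preim_sets)

lemma count_funs_pull_along: "\<phi> \<in> count_funs \<Y> \<Longrightarrow> pull_along \<X> f \<phi> \<in> count_funs \<X>"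
  unfolding count_funs_def
  by (auto simp: fibre_count_coprod_morph_preim[symmetric] coprod_morph_preim_coprods)

text \<open>
  Equivariance is given for preimages of sets; it carries over to count functions, since these count
  the points of coproducts of such sets.
\<close>
lemma pull_along_pull:
  assumes "t \<in> carrier (monoid_of \<Y>)" "\<phi> \<in> count_funs \<Y>"
  shows "pull_along \<X> f (pull \<Y> t \<phi>) = pull \<X> (h t) (pull_along \<X> f \<phi>)"
proof -
  obtain B where B: "B \<in> coprods \<Y>" "\<phi> = fibre_count B"
    using assms(2) unfolding count_funs_def by blast
  have "coprod_morph_preim \<X> f (coprod_preim \<Y> t B) = coprod_preim \<X> (h t) (coprod_morph_preim \<X> f B)"
    using B(1) by (auto simp: coprods_def coprod_morph_preim_def coprod_preim_def equivariant[OF assms(1)])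
  then show ?thesis
    unfolding B(2) fibre_count_coprod_morph_preim[symmetric] fibre_count_coprod_preim[symmetric]
    by simp
qed

lemma elem_equidec_pull_along:
  assumes "\<phi> \<in> count_funs \<Y>" "\<psi> \<in> count_funs \<Y>" "elem_equidec \<Y> \<phi> \<psi>"
  shows "elem_equidec \<X> (pull_along \<X> f \<phi>) (pull_along \<X> f \<psi>)"
proof -
  obtain s t where st: "s \<in> carrier (monoid_of \<Y>)" "t \<in> carrier (monoid_of \<Y>)"
    "pull \<Y> s \<phi> = pull \<Y> t \<psi>"
    using assms(3) unfolding elem_equidec_def by blast
  have "pull \<X> (h s) (pull_along \<X> f \<phi>) = pull \<X> (h t) (pull_along \<X> f \<psi>)"
    using st assms(1,2) by (simp add: pull_along_pull[symmetric])
  then show ?thesis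
    unfolding elem_equidec_def using h_closed st(1,2) by blast
qed

lemma fun_equidec_pull_along:
  assumes "fun_equidec \<Y> \<phi> \<psi>"
  shows "fun_equidec \<X> (pull_along \<X> f \<phi>) (pull_along \<X> f \<psi>)"
proof -
  obtain \<Phi> \<Psi> where "\<forall>j. \<Phi> j \<in> count_funs \<Y>" "\<forall>j. \<Psi> j \<in> count_funs \<Y>"
    "\<forall>j. elem_equidec \<Y> (\<Phi> j) (\<Psi> j)" and sums: "\<phi> = fsum \<Phi>" "\<psi> = fsum \<Psi>"
    by (rule target.fun_equidecE[OF assms])
  note * = this(1-3)[rule_format]
  show ?thesis
    unfolding sums pull_along_fsum
    by (rule source.fun_equidecI[OF _ _ _ refl refl])
       (use * in \<open>simp_all add: count_funs_pull_along elem_equidec_pull_along\<close>)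
qed

lemma type_map_fun_type:
  assumes "\<phi> \<in> count_funs \<Y>"
  shows "type_map \<X> \<Y> f (fun_type \<Y> \<phi>) = fun_type \<X> (pull_along \<X> f \<phi>)"
proof -
  have "equidec_class \<X> (coprod_morph_preim \<X> f B) = fun_type \<X> (pull_along \<X> f \<phi>)"
    if "B \<in> fun_type \<Y> \<phi>" for B
    using target.fun_typeD[OF that]
    by (simp add: source.equidec_class_eq_fun_type coprod_morph_preim_coprods
        fibre_count_coprod_morph_preim source.fun_type_cong fun_equidec_pull_along)
  moreover obtain B where "B \<in> fun_type \<Y> \<phi>"
    by (rule target.fun_type_nonempty[OF assms])
  ultimately show ?thesis
    unfolding type_map_def by auto
qed

lemma type_map_closed:
  "\<beta> \<in> carrier (type_monoid \<Y>) \<Longrightarrow> type_map \<X> \<Y> f \<beta> \<in> carrier (type_monoid \<X>)"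
  by (elim target.carrier_type_monoidE) (simp add: type_map_fun_type source.fun_type_closed count_funs_pull_along)

lemma type_map_equidec_class:
  "B \<in> coprods \<Y> \<Longrightarrow>
    type_map \<X> \<Y> f (equidec_class \<Y> B) = equidec_class \<X> (coprod_morph_preim \<X> f B)"
  by (simp add: target.equidec_class_eq_fun_type source.equidec_class_eq_fun_type type_map_fun_type
      fibre_count_count_funs coprod_morph_preim_coprods fibre_count_coprod_morph_preim)

lemma type_map_monoid_hom: "type_map \<X> \<Y> f \<in> monoid_hom (type_monoid \<Y>) (type_monoid \<X>)"
proof -
  have "type_map \<X> \<Y> f (\<alpha> \<otimes>\<^bsub>type_monoid \<Y>\<^esub> \<beta>) =
      type_map \<X> \<Y> f \<alpha> \<otimes>\<^bsub>type_monoid \<X>\<^esub> type_map \<X> \<Y> f \<beta>"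
    if \<alpha>: "\<alpha> \<in> carrier (type_monoid \<Y>)" and \<beta>: "\<beta> \<in> carrier (type_monoid \<Y>)" for \<alpha> \<beta>
  proof -
    obtain \<phi> where "\<phi> \<in> count_funs \<Y>" "\<alpha> = fun_type \<Y> \<phi>"
      by (rule target.carrier_type_monoidE[OF \<alpha>])
    moreover obtain \<psi> where "\<psi> \<in> count_funs \<Y>" "\<beta> = fun_type \<Y> \<psi>"
      by (rule target.carrier_type_monoidE[OF \<beta>])
    ultimately show ?thesis
      by (simp add: target.fun_type_fadd source.fun_type_fadd type_map_fun_type
          count_funs_fadd count_funs_pull_along pull_along_fadd)
  qed
  moreover have "type_map \<X> \<Y> f \<one>\<^bsub>type_monoid \<Y>\<^esub> = \<one>\<^bsub>type_monoid \<X>\<^esub>"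
    by (simp add: target.one_type_monoid source.one_type_monoid type_map_fun_type count_funs_zero
        pull_along_zero)
  ultimately show ?thesis
    unfolding monoid_hom_def hom_def using type_map_closed by blast
qed

lemma type_map_type_sum:
  assumes "\<And>i. a i \<in> carrier (type_monoid \<Y>)"
  shows "type_map \<X> \<Y> f (type_sum \<Y> a) = type_sum \<X> (\<lambda>i. type_map \<X> \<Y> f (a i))"
proof -
  obtain \<Phi> where "\<forall>i. \<Phi> i \<in> count_funs \<Y>" and a: "a = (\<lambda>i. fun_type \<Y> (\<Phi> i))"
    by (rule target.carrier_type_monoid_seqE[OF assms])
  then show ?thesis
    by (simp add: target.fun_type_fsum source.fun_type_fsum type_map_fun_type count_funs_fsum
        count_funs_pull_along pull_along_fsum)
qed

lemma tarski_measure_morph_preim: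
  assumes "B \<in> sets (meas \<Y>)"
  shows "tarski_measure \<X> (morph_preim \<X> f B) = type_map \<X> \<Y> f (tarski_measure \<Y> B)"
proof -
  have "coprod_morph_preim \<X> f (single B) = single (morph_preim \<X> f B)"
    by (rule ext) (simp add: coprod_morph_preim_def single_def morph_preim_def)
  then show ?thesis
    unfolding tarski_measure_def using type_map_equidec_class[OF single_coprods[OF assms]] by simp
qed

end

lemma stat_meas_morphism_id:
  assumes "stat_meas_space \<X>"
  shows "stat_meas_morphism \<X> \<X> (\<lambda>x. x) (\<lambda>s. s)"
proof -
  interpret stat_meas_space \<X>
    by (rule assms)
  show ?thesis
  proof unfold_locales
    show "(\<lambda>s. s) \<in> monoid_hom (monoid_of \<X>) (monoid_of \<X>)"
      by (simp add: monoid_hom_def hom_def)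
    show "morph_preim \<X> (\<lambda>x. x) (preim \<X> s A) = preim \<X> s (morph_preim \<X> (\<lambda>x. x) A)"
      if "s \<in> carrier (monoid_of \<X>)" for s A
      using act_space[OF that] by (auto simp: morph_preim_def preim_def)
  qed simp
qed

lemma type_map_id:
  assumes "stat_meas_space \<X>" "\<alpha> \<in> carrier (type_monoid \<X>)"
  shows "type_map \<X> \<X> (\<lambda>x. x) \<alpha> = \<alpha>"
proof -
  interpret stat_meas_morphism \<X> \<X> "\<lambda>x. x" "\<lambda>s. s"
    by (rule stat_meas_morphism_id[OF assms(1)])
  obtain \<phi> where \<phi>: "\<phi> \<in> count_funs \<X>" "\<alpha> = fun_type \<X> \<phi>"
    by (rule source.carrier_type_monoidE[OF assms(2)])
  have "pull_along \<X> (\<lambda>x. x) \<phi> = \<phi>"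
    using \<phi>(1) by (auto simp: pull_along_def count_funs_iff)
  then show ?thesis
    by (simp add: \<phi> type_map_fun_type)
qed

lemma stat_meas_morphism_comp:
  assumes "stat_meas_morphism \<X> \<Y> f h" "stat_meas_morphism \<Y> \<Z> g k"
  shows "stat_meas_morphism \<X> \<Z> (g \<circ> f) (h \<circ> k)"
proof -
  interpret f: stat_meas_morphism \<X> \<Y> f h
    by (rule assms(1))
  interpret g: stat_meas_morphism \<Y> \<Z> g k
    by (rule assms(2))
  have comp: "morph_preim \<X> (g \<circ> f) C = morph_preim \<X> f (morph_preim \<Y> g C)" for C
    using f.f_space by (auto simp: morph_preim_def)
  show ?thesis
  proof unfold_locales
    show "g \<circ> f \<in> meas \<X> \<rightarrow>\<^sub>M meas \<Z>"
      by (rule measurable_comp[OF f.f_measurable g.f_measurable])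
    show "h \<circ> k \<in> monoid_hom (monoid_of \<Z>) (monoid_of \<X>)"
      using f.h_hom g.h_hom by (auto simp: monoid_hom_def hom_def Pi_iff)
    show "morph_preim \<X> (g \<circ> f) (preim \<Z> u C) = preim \<X> ((h \<circ> k) u) (morph_preim \<X> (g \<circ> f) C)"
      if "u \<in> carrier (monoid_of \<Z>)" "C \<in> sets (meas \<Z>)" for u C
      using that by (simp add: comp g.equivariant f.equivariant g.h_closed g.morph_preim_sets)
  qed
qed

lemma type_map_comp:
  assumes "stat_meas_morphism \<X> \<Y> f h" "stat_meas_morphism \<Y> \<Z> g k"
    and "\<gamma> \<in> carrier (type_monoid \<Z>)"
  shows "type_map \<X> \<Z> (g \<circ> f) \<gamma> = type_map \<X> \<Y> f (type_map \<Y> \<Z> g \<gamma>)"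
proof -
  interpret f: stat_meas_morphism \<X> \<Y> f h
    by (rule assms(1))
  interpret g: stat_meas_morphism \<Y> \<Z> g k
    by (rule assms(2))
  interpret gf: stat_meas_morphism \<X> \<Z> "g \<circ> f" "h \<circ> k"
    by (rule stat_meas_morphism_comp[OF assms(1,2)])
  obtain \<phi> where \<phi>: "\<phi> \<in> count_funs \<Z>" "\<gamma> = fun_type \<Z> \<phi>"
    by (rule g.target.carrier_type_monoidE[OF assms(3)])
  have "pull_along \<X> (g \<circ> f) \<phi> = pull_along \<X> f (pull_along \<Y> g \<phi>)"
    using f.f_space by (auto simp: pull_along_def)
  then show ?thesis
    using \<phi> by (simp add: gf.type_map_fun_type f.type_map_fun_type g.type_map_fun_type
        g.count_funs_pull_along)
qed


section \<open>The Tarski measure and the canonical order\<close>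

context stat_meas_space
begin

lemma mult_equidec_class:
  "P \<in> coprods \<X> \<Longrightarrow> Q \<in> coprods \<X> \<Longrightarrow>
    equidec_class \<X> P \<otimes>\<^bsub>type_monoid \<X>\<^esub> equidec_class \<X> Q = equidec_class \<X> (coprod2 P Q)"
  by (simp add: equidec_class_eq_fun_type fun_type_fadd fibre_count_count_funs coprod2_coprods
      fibre_count_coprod2)

lemma type_sum_equidec_class:
  "(\<And>i. P i \<in> coprods \<X>) \<Longrightarrow>
    type_sum \<X> (\<lambda>i. equidec_class \<X> (P i)) = equidec_class \<X> (Coprod P)"
  by (simp add: equidec_class_eq_fun_type fun_type_fsum fibre_count_count_funs Coprod_coprods
      fibre_count_Coprod)

lemma partial_order_canonical_preorder:
  "partial_order_on (carrier (type_monoid \<X>)) (canonical_preorder (type_monoid \<X>))"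
proof -
  have iff: "(\<alpha>, \<beta>) \<in> canonical_preorder (type_monoid \<X>) \<longleftrightarrow>
      \<alpha> \<in> carrier (type_monoid \<X>) \<and> \<beta> \<in> carrier (type_monoid \<X>) \<and> type.le \<alpha> \<beta>" for \<alpha> \<beta>
    by (simp add: canonical_preorder_def type.le_def)
  show ?thesis
    unfolding partial_order_on_def preorder_on_def
  proof (intro conjI)
    show "canonical_preorder (type_monoid \<X>) \<subseteq> carrier (type_monoid \<X>) \<times> carrier (type_monoid \<X>)"
      using iff by auto
    show "refl_on (carrier (type_monoid \<X>)) (canonical_preorder (type_monoid \<X>))"
      by (auto intro!: refl_onI type.le_refl simp: iff)
    show "trans (canonical_preorder (type_monoid \<X>))"
      unfolding trans_def iff using type.le_trans by blast
    show "antisym (canonical_preorder (type_monoid \<X>))"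
      unfolding antisym_def iff using type.le_antisym by blast
  qed
qed

lemma tarski_measure_eq_fun_type:
  "A \<in> sets (meas \<X>) \<Longrightarrow> tarski_measure \<X> A = fun_type \<X> (indicator A)"
  by (simp add: tarski_measure_def equidec_class_eq_fun_type single_coprods fibre_count_single)

lemma indicator_count_funs: "A \<in> sets (meas \<X>) \<Longrightarrow> indicator A \<in> count_funs \<X>"
  using fibre_count_count_funs[OF single_coprods] by (simp add: fibre_count_single)

lemma tarski_measure_closed: "A \<in> sets (meas \<X>) \<Longrightarrow> tarski_measure \<X> A \<in> carrier (type_monoid \<X>)"
  by (simp add: tarski_measure_eq_fun_type indicator_count_funs fun_type_closed)

lemma tarski_measure_UN:
  assumes "range A \<subseteq> sets (meas \<X>)" "disjoint_family A"
  shows "tarski_measure \<X> (\<Union>i. A i) = type_sum \<X> (\<lambda>i. tarski_measure \<X> (A i))"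
proof -
  have A: "A i \<in> sets (meas \<X>)" for i
    using assms(1) by blast
  have "indicator (\<Union>i. A i) = fsum (\<lambda>i. indicator (A i))"
    using suminf_indicator[OF assms(2)] by (auto simp: fsum_def)
  then show ?thesis
    using A by (simp add: tarski_measure_eq_fun_type fun_type_fsum indicator_count_funs)
qed

lemma tarski_measure_preim:
  assumes "A \<in> sets (meas \<X>)" "s \<in> carrier (monoid_of \<X>)"
  shows "tarski_measure \<X> A = tarski_measure \<X> (preim \<X> s A)"
proof -
  have "indicator (preim \<X> s A) = pull \<X> s (indicator A)"
    by (auto simp: preim_def pull_def indicator_def)
  moreover have "fun_equidec \<X> (indicator A) (pull \<X> s (indicator A))"
    using assms by (intro fun_equidec_elem elem_equidec_pull indicator_count_funs count_funs_pull)
  ultimately show ?thesis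
    using assms by (simp add: tarski_measure_eq_fun_type preim_sets fun_type_cong)
qed

end


section \<open>The Tarski type functor\<close>

theorem theorem1:
  shows
    \<comment> \<open>the construction is well defined on objects\<close>
    "(\<forall>\<X> :: ('x, 's) stat_space. stat_meas_space \<X> \<longrightarrow>
        equiv (coprods \<X>) (same_coprod \<X>) \<and>
        equiv (coprods \<X>) (equidec \<X>) \<and>
        (\<forall>P\<in>coprods \<X>. \<forall>Q\<in>coprods \<X>.
          equidec_class \<X> P \<otimes>\<^bsub>type_monoid \<X>\<^esub> equidec_class \<X> Q = equidec_class \<X> (coprod2 P Q)) \<and>
        (\<forall>P. (\<forall>i. P i \<in> coprods \<X>) \<longrightarrow>
          type_sum \<X> (\<lambda>i. equidec_class \<X> (P i)) = equidec_class \<X> (Coprod P)) \<and>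
        monoid (type_monoid \<X>))
    \<and>
    \<comment> \<open>the construction is well defined on morphisms\<close>
    (\<forall>(\<X> :: ('x, 's) stat_space) (\<Y> :: ('y, 't) stat_space) f. stat_morphism \<X> \<Y> f \<longrightarrow>
        (\<forall>B\<in>coprods \<Y>.
          type_map \<X> \<Y> f (equidec_class \<Y> B) = equidec_class \<X> (coprod_morph_preim \<X> f B)) \<and>
        type_map \<X> \<Y> f \<in> monoid_hom (type_monoid \<Y>) (type_monoid \<X>))
    \<and>
    \<comment> \<open>contravariant functoriality\<close>
    (\<forall>\<X> :: ('x, 's) stat_space. stat_meas_space \<X> \<longrightarrow>
        stat_morphism \<X> \<X> (\<lambda>x. x) \<and>
        (\<forall>\<alpha>\<in>carrier (type_monoid \<X>). type_map \<X> \<X> (\<lambda>x. x) \<alpha> = \<alpha>))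
    \<and>
    (\<forall>(\<X> :: ('x, 's) stat_space) (\<Y> :: ('y, 't) stat_space) (\<Z> :: ('z, 'u) stat_space) f g.
        stat_morphism \<X> \<Y> f \<and> stat_morphism \<Y> \<Z> g \<longrightarrow>
        stat_morphism \<X> \<Z> (g \<circ> f) \<and>
        (\<forall>\<gamma>\<in>carrier (type_monoid \<Z>).
          type_map \<X> \<Z> (g \<circ> f) \<gamma> = type_map \<X> \<Y> f (type_map \<Y> \<Z> g \<gamma>)))
    \<and>
    \<comment> \<open>(1); the type monoid is written multiplicatively, so the power is the \<open>n\<close>-fold sum\<close>
    (\<forall>\<X> :: ('x, 's) stat_space. stat_meas_space \<X> \<longrightarrow>
        (\<forall>\<alpha>\<in>carrier (type_monoid \<X>). \<forall>\<beta>\<in>carrier (type_monoid \<X>).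
          \<alpha> \<otimes>\<^bsub>type_monoid \<X>\<^esub> \<beta> = \<beta> \<otimes>\<^bsub>type_monoid \<X>\<^esub> \<alpha>) \<and>
        partial_order_on (carrier (type_monoid \<X>)) (canonical_preorder (type_monoid \<X>)) \<and>
        (\<forall>\<alpha>\<in>carrier (type_monoid \<X>). \<forall>\<beta>\<in>carrier (type_monoid \<X>). \<forall>n::nat.
          1 \<le> n \<and> \<alpha> [^]\<^bsub>type_monoid \<X>\<^esub> n = \<beta> [^]\<^bsub>type_monoid \<X>\<^esub> n \<longrightarrow> \<alpha> = \<beta>))
    \<and>
    \<comment> \<open>(2)\<close>
    (\<forall>\<X> :: ('x, 's) stat_space. stat_meas_space \<X> \<longrightarrow>
        tarski_measure \<X> \<in> sets (meas \<X>) \<rightarrow> carrier (type_monoid \<X>) \<and>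
        tarski_measure \<X> {} = \<one>\<^bsub>type_monoid \<X>\<^esub> \<and>
        (\<forall>A :: nat \<Rightarrow> 'x set. range A \<subseteq> sets (meas \<X>) \<and> disjoint_family A \<longrightarrow>
          tarski_measure \<X> (\<Union>i. A i) = type_sum \<X> (\<lambda>i. tarski_measure \<X> (A i))) \<and>
        (\<forall>A\<in>sets (meas \<X>). \<forall>s\<in>carrier (monoid_of \<X>).
          tarski_measure \<X> A = tarski_measure \<X> (preim \<X> s A)))
    \<and>
    \<comment> \<open>(3)\<close>
    (\<forall>(\<X> :: ('x, 's) stat_space) (\<Y> :: ('y, 't) stat_space) f. stat_morphism \<X> \<Y> f \<longrightarrow>
        (\<forall>a. (\<forall>i. a i \<in> carrier (type_monoid \<Y>)) \<longrightarrow>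
          type_map \<X> \<Y> f (type_sum \<Y> a) = type_sum \<X> (\<lambda>i. type_map \<X> \<Y> f (a i))) \<and>
        (\<forall>B\<in>sets (meas \<Y>).
          tarski_measure \<X> (morph_preim \<X> f B) = type_map \<X> \<Y> f (tarski_measure \<Y> B)))"
proof (intro conjI allI impI ballI)
  fix \<X> :: "('x, 's) stat_space"
  assume "stat_meas_space \<X>"
  then interpret stat_meas_space \<X> .
  show "equiv (coprods \<X>) (same_coprod \<X>)"
    by (rule equiv_same_coprod)
  show "equiv (coprods \<X>) (equidec \<X>)"
    by (rule equiv_equidec)
  show "monoid (type_monoid \<X>)"
    by unfold_locales
  show "stat_morphism \<X> \<X> (\<lambda>x. x)"
    unfolding stat_morphism_iff using stat_meas_morphism_id[OF stat_meas_space_axioms] by blast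
  show "partial_order_on (carrier (type_monoid \<X>)) (canonical_preorder (type_monoid \<X>))"
    by (rule partial_order_canonical_preorder)
  show "tarski_measure \<X> \<in> sets (meas \<X>) \<rightarrow> carrier (type_monoid \<X>)"
    by (auto intro: tarski_measure_closed)
  show "tarski_measure \<X> {} = \<one>\<^bsub>type_monoid \<X>\<^esub>"
    by (simp add: tarski_measure_def type_monoid_def)
  show "equidec_class \<X> P \<otimes>\<^bsub>type_monoid \<X>\<^esub> equidec_class \<X> Q = equidec_class \<X> (coprod2 P Q)"
    if "P \<in> coprods \<X>" "Q \<in> coprods \<X>" for P Q
    using that by (rule mult_equidec_class)
  show "type_sum \<X> (\<lambda>i. equidec_class \<X> (P i)) = equidec_class \<X> (Coprod P)"
    if "\<forall>i. P i \<in> coprods \<X>" for P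
    using that by (simp add: type_sum_equidec_class)
  show "type_map \<X> \<X> (\<lambda>x. x) \<alpha> = \<alpha>" if "\<alpha> \<in> carrier (type_monoid \<X>)" for \<alpha>
    using stat_meas_space_axioms that by (rule type_map_id)
  show "\<alpha> \<otimes>\<^bsub>type_monoid \<X>\<^esub> \<beta> = \<beta> \<otimes>\<^bsub>type_monoid \<X>\<^esub> \<alpha>"
    if "\<alpha> \<in> carrier (type_monoid \<X>)" "\<beta> \<in> carrier (type_monoid \<X>)" for \<alpha> \<beta>
    using that by (rule type.m_comm)
  show "\<alpha> = \<beta>"
    if "\<alpha> \<in> carrier (type_monoid \<X>)" "\<beta> \<in> carrier (type_monoid \<X>)"
      "1 \<le> n \<and> \<alpha> [^]\<^bsub>type_monoid \<X>\<^esub> n = \<beta> [^]\<^bsub>type_monoid \<X>\<^esub> n" for \<alpha> \<beta> and n :: nat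
    using that type.pow_cancel by blast
  show "tarski_measure \<X> (\<Union>i. A i) = type_sum \<X> (\<lambda>i. tarski_measure \<X> (A i))"
    if "range A \<subseteq> sets (meas \<X>) \<and> disjoint_family A" for A :: "nat \<Rightarrow> 'x set"
    using that by (simp add: tarski_measure_UN)
  show "tarski_measure \<X> A = tarski_measure \<X> (preim \<X> s A)"
    if "A \<in> sets (meas \<X>)" "s \<in> carrier (monoid_of \<X>)" for A s
    using that by (rule tarski_measure_preim)
next
  fix \<X> :: "('x, 's) stat_space" and \<Y> :: "('y, 't) stat_space" and f
  assume "stat_morphism \<X> \<Y> f"
  then obtain h where "stat_meas_morphism \<X> \<Y> f h"
    unfolding stat_morphism_iff by blast
  then interpret stat_meas_morphism \<X> \<Y> f h .
  show "type_map \<X> \<Y> f (equidec_class \<Y> B) = equidec_class \<X> (coprod_morph_preim \<X> f B)"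
    if "B \<in> coprods \<Y>" for B
    using that by (rule type_map_equidec_class)
  show "type_map \<X> \<Y> f \<in> monoid_hom (type_monoid \<Y>) (type_monoid \<X>)"
    by (rule type_map_monoid_hom)
  show "type_map \<X> \<Y> f (type_sum \<Y> a) = type_sum \<X> (\<lambda>i. type_map \<X> \<Y> f (a i))"
    if "\<forall>i. a i \<in> carrier (type_monoid \<Y>)" for a
    using that by (simp add: type_map_type_sum)
  show "tarski_measure \<X> (morph_preim \<X> f B) = type_map \<X> \<Y> f (tarski_measure \<Y> B)"
    if "B \<in> sets (meas \<Y>)" for B
    using that by (rule tarski_measure_morph_preim)
next
  fix \<X> :: "('x, 's) stat_space" and \<Y> :: "('y, 't) stat_space" and \<Z> :: "('z, 'u) stat_space"
    and f g
  assume "stat_morphism \<X> \<Y> f \<and> stat_morphism \<Y> \<Z> g"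
  then obtain h k where hk: "stat_meas_morphism \<X> \<Y> f h" "stat_meas_morphism \<Y> \<Z> g k"
    unfolding stat_morphism_iff by blast
  show "stat_morphism \<X> \<Z> (g \<circ> f)"
    unfolding stat_morphism_iff using stat_meas_morphism_comp[OF hk] by blast
  show "type_map \<X> \<Z> (g \<circ> f) \<gamma> = type_map \<X> \<Y> f (type_map \<Y> \<Z> g \<gamma>)"
    if "\<gamma> \<in> carrier (type_monoid \<Z>)" for \<gamma>
    using hk that by (rule type_map_comp)
qed

end
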